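(* Let $H$ be a separable real Hilbert space with scalar product $(\cdot,\cdot)$ and norm $\|\cdot\|$, let $\rho$ be a Borel probability measure on the unit sphere $S_H=\{\omega\in H:\|\omega\|=1\}$, and let $L$, $\tilde H$, $H_L^{1/2}$, $A_2$, the iterates $u^{(m)}$ and $\delta_m^2=\|u-u^{(m)}\|^2$ be as defined in the context. Then: (i) For arbitrary $u\in H_L^{1/2}$ the algorithm converges in expectation, with $$\mathbb{E}(\delta_m^2)\le\frac{\|u\|_{H_L^{1/2}}^2}{m+1},\qquad m=0,1,2,\ldots.$$ (ii) For any $u\in H$ and any $h\in H_L^{1/2}$, $$\mathbb{E}(\delta_m^2)^{1/2}\le 2\left(\|u-h\|+\frac{\left(\|h\|_{H_L^{1/2}}^2+\|u\|^2\right)^{1/2}}{(m+1)^{1/2}}\right),\qquad m=0,1,2,\ldots.$$ (iii) Convergence in expectation, $\mathbb{E}(\delta_m^2)\to0$ as $m\to\infty$, holds for any $u\in\tilde H$. (iv) The classes $A_2$ and $H_L^{1/2}$ coincide, with equality of norms $\|u\|_{A_2}=\|u\|_{H_L^{1/2}}$ for any $u\in H_L^{1/2}$.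
   Context: Covariance operator. $L:H\to H$ is given by the Bochner integral $Lv=\int_{S_H}(v,\omega)\,\omega\,d\rho_\omega$, $v\in H$. It is positive semi-definite and trace-class. Let $\tilde H:=H\ominus\mathrm{Ker}(L)$ be the orthogonal complement of $\mathrm{Ker}(L)$, and let $\{\psi_k\}$ be a complete orthonormal system in $\tilde H$ of eigenfunctions of $L$ with associated eigenvalues $\mu_k>0$ (so $\sum_k\mu_k=1$). For $s>0$, $$H_L^s=L^s(H):=\Big\{v=\sum_k\mu_k^s c_k\psi_k:\ \|v\|_{H_L^s}:=\Big(\sum_k c_k^2\Big)^{1/2}<\infty\Big\}.$$ The class $A_2$. An element $u\in H$ belongs to $A_2$ iff there is a measurable function $\omega\mapsto c_\omega\in\mathbb{R}$ on $S_H$ with $$u=\int_{S_H}c_\omega\,\omega\,d\rho_\omega\ \text{ (Bochner integral)},\qquad\int_{S_H}c_\omega^2\,d\rho_\omega<\infty,$$ and $\|u\|_{A_2}:=\inf\left(\int_{S_H}c_\omega^2\,d\rho_\omega\right)^{1/2}$, the infimum being over all such representations of $u$. Algorithm (for recovering a given $u\in H$). Let $\omega_0,\omega_1,\ldots$ be independent samples from $S_H$, identically distributed according to $\rho$. Set $u^{(0)}=0$ and, for $m=0,1,\ldots$, $$u^{(m+1)}=\alpha_m u^{(m)}+\xi_m r^{(m)}_{\omega_m},\qquad r^{(m)}_{\omega_m}=(u-u^{(m)},\omega_m)\,\omega_m,\qquad\alpha_m=1-\frac1{m+2},$$ where $\xi_m\in\mathbb{R}$ minimizes $\xi\mapsto\|u-\alpha_m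 u^{(m)}-\xi r^{(m)}_{\omega_m}\|^2$ (if $r^{(m)}_{\omega_m}=0$ the value of $\xi_m$ is irrelevant). $\mathbb{E}$ denotes expectation with respect to the random choice of the $\omega_m$ (i.e. with respect to the product measure $\rho^m$ for $\delta_m^2$). *)

theory Defs
  imports "HOL-Probability.Probability"
begin

text \<open>A separable real Hilbert space is a type of sort
  \<open>{real_inner, banach, second_countable_topology}\<close>; the sphere \<open>S_H\<close> is \<open>sphere 0 1\<close>.\<close>

definition sphere_prob :: "'a::{real_inner, banach, second_countable_topology} measure \<Rightarrow> bool" where
  "sphere_prob \<rho> \<longleftrightarrow> prob_space \<rho> \<and> sets \<rho> = sets (restrict_space borel (sphere 0 1))"

definition cov_op :: "'a::{real_inner, banach, second_countable_topology} measure \<Rightarrow> 'a \<Rightarrow> 'a" where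
  "cov_op \<rho> v = (LINT \<omega>|\<rho>. (v \<bullet> \<omega>) *\<^sub>R \<omega>)"

definition H_tilde :: "'a::{real_inner, banach, second_countable_topology} measure \<Rightarrow> 'a set" where
  "H_tilde \<rho> = orthogonal_comp {v. cov_op \<rho> v = 0}"

text \<open>The index set \<open>K\<close> may be finite or infinite. Orthonormal systems in a separable space are
  countable, so \<open>K :: nat set\<close> is no restriction. Completeness in \<open>H_tilde \<rho>\<close> means
  that the closed linear span is all of \<open>H_tilde \<rho>\<close>.\<close>

definition eigensystem ::
  "'a::{real_inner, banach, second_countable_topology} measure
    \<Rightarrow> nat set \<Rightarrow> (nat \<Rightarrow> 'a) \<Rightarrow> (nat \<Rightarrow> real) \<Rightarrow> bool" where
  "eigensystem \<rho> K \<psi> \<mu> \<longleftrightarrow>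
     (\<forall>j\<in>K. \<forall>k\<in>K. \<psi> j \<bullet> \<psi> k = (if j = k then 1 else 0)) \<and>
     closure (span (\<psi> ` K)) = H_tilde \<rho> \<and>
     (\<forall>k\<in>K. \<mu> k > 0 \<and> cov_op \<rho> (\<psi> k) = \<mu> k *\<^sub>R \<psi> k)"

definition HL_rep ::
  "nat set \<Rightarrow> (nat \<Rightarrow> 'a::real_inner) \<Rightarrow> (nat \<Rightarrow> real) \<Rightarrow> real \<Rightarrow> 'a \<Rightarrow> (nat \<Rightarrow> real) \<Rightarrow> bool" where
  "HL_rep K \<psi> \<mu> s v c \<longleftrightarrow>
     ((\<lambda>k. (\<mu> k powr s * c k) *\<^sub>R \<psi> k) has_sum v) K \<and> (\<lambda>k. (c k)\<^sup>2) summable_on K"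

definition HL_space ::
  "nat set \<Rightarrow> (nat \<Rightarrow> 'a::real_inner) \<Rightarrow> (nat \<Rightarrow> real) \<Rightarrow> real \<Rightarrow> 'a set" where
  "HL_space K \<psi> \<mu> s = {v. \<exists>c. HL_rep K \<psi> \<mu> s v c}"

text \<open>For an eigensystem the coefficients \<open>c k\<close>, \<open>k \<in> K\<close>, of \<open>v\<close> are unique, since
  \<open>\<mu> k powr s * c k = v \<bullet> \<psi> k\<close>; hence the description below is definite on \<open>HL_space\<close>.\<close>

definition HL_norm ::
  "nat set \<Rightarrow> (nat \<Rightarrow> 'a::real_inner) \<Rightarrow> (nat \<Rightarrow> real) \<Rightarrow> real \<Rightarrow> 'a \<Rightarrow> real" where
  "HL_norm K \<psi> \<mu> s v = (THE x. \<exists>c. HL_rep K \<psi> \<mu> s v c \<and> x = sqrt (\<Sum>\<^sub>\<infinity>k\<in>K. (c k)\<^sup>2))"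

definition A2_rep ::
  "'a::{real_inner, banach, second_countable_topology} measure \<Rightarrow> 'a \<Rightarrow> ('a \<Rightarrow> real) \<Rightarrow> bool" where
  "A2_rep \<rho> u c \<longleftrightarrow>
     c \<in> borel_measurable \<rho> \<and>
     integrable \<rho> (\<lambda>\<omega>. c \<omega> *\<^sub>R \<omega>) \<and> u = (LINT \<omega>|\<rho>. c \<omega> *\<^sub>R \<omega>) \<and>
     integrable \<rho> (\<lambda>\<omega>. (c \<omega>)\<^sup>2)"

definition A2 :: "'a::{real_inner, banach, second_countable_topology} measure \<Rightarrow> 'a set" where
  "A2 \<rho> = {u. \<exists>c. A2_rep \<rho> u c}"

definition A2_norm :: "'a::{real_inner, banach, second_countable_topology} measure \<Rightarrow> 'a \<Rightarrow> real" where
  "A2_norm \<rho> u = Inf {sqrt (LINT \<omega>|\<rho>. (c \<omega>)\<^sup>2) | c. A2_rep \<rho> u c}"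

text \<open>\<open>iter u w m\<close> is the iterate \<open>u^(m)\<close> for the sample sequence \<open>w\<close>; it depends only on
  \<open>w 0, ..., w (m - 1)\<close>. If the residual \<open>r\<close> vanishes, every real is a minimizer
  and the choice made by \<open>arg_min\<close> does not matter.\<close>

primrec iter :: "'a::real_inner \<Rightarrow> (nat \<Rightarrow> 'a) \<Rightarrow> nat \<Rightarrow> 'a" where
  "iter u w 0 = 0"
| "iter u w (Suc m) =
     (let \<alpha> = 1 - 1 / (real m + 2);
          r = ((u - iter u w m) \<bullet> w m) *\<^sub>R w m;
          \<xi> = arg_min (\<lambda>\<xi>::real. (norm (u - \<alpha> *\<^sub>R iter u w m - \<xi> *\<^sub>R r))\<^sup>2) (\<lambda>_. True)
      in \<alpha> *\<^sub>R iter u w m + \<xi> *\<^sub>R r)"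

definition delta_sq :: "'a::real_inner \<Rightarrow> (nat \<Rightarrow> 'a) \<Rightarrow> nat \<Rightarrow> real" where
  "delta_sq u w m = (norm (u - iter u w m))\<^sup>2"

definition iid_samples ::
  "'b measure \<Rightarrow> 'a measure \<Rightarrow> (nat \<Rightarrow> 'b \<Rightarrow> 'a) \<Rightarrow> bool" where
  "iid_samples M \<rho> W \<longleftrightarrow>
     prob_space M \<and> prob_space.indep_vars M (\<lambda>_. \<rho>) W UNIV \<and> (\<forall>i. distr M \<rho> (W i) = \<rho>)"

definition expected_delta_sq ::
  "'b measure \<Rightarrow> (nat \<Rightarrow> 'b \<Rightarrow> 'a) \<Rightarrow> 'a::real_inner \<Rightarrow> nat \<Rightarrow> real" where
  "expected_delta_sq M W u m = (LINT x|M. delta_sq u (\<lambda>i. W i x) m)"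

end

theory Submission
  imports Defs "HOL-Real_Asymp.Real_Asymp"
begin

text \<open>
  Write \<open>e = u - v\<close> for the residual at an iterate \<open>v\<close> and \<open>b = 1 / (m + 2)\<close>. Unless \<open>e \<bullet> \<omega> = 0\<close>,
  the line search removes from \<open>(1 - b) e + b u\<close> its whole component along the unit vector \<open>\<omega>\<close>,
  so it does at least as well as subtracting \<open>b c(\<omega>) \<omega>\<close>, for any number \<open>c(\<omega>)\<close>. Let
  \<open>h = \<integral> c(\<omega>) \<omega> d\<rho>\<close>. Averaging over \<open>\<omega>\<close> replaces \<open>c(\<omega>) \<omega>\<close> by \<open>h\<close> in the cross term, and with
  \<open>C = \<integral> c\<^sup>2 d\<rho>\<close> the expected squared residual after the step is at most
  \<open>(1 - b)\<^sup>2 \<parallel>e\<parallel>\<^sup>2 + 2 (1 - b) b (e \<bullet> (u - h)) + b\<^sup>2 (2 \<parallel>u\<parallel>\<^sup>2 + C - 2 u \<bullet> h)\<close>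
  (lemma \<open>integral_residual_next_iterate_sq_le\<close>). In the exceptional case \<open>e \<bullet> \<omega> = 0\<close> nothing can be
  subtracted; this costs at most \<open>b\<^sup>2 (u \<bullet> \<omega>)\<^sup>2\<close>, which accounts for one of the two copies of
  \<open>\<parallel>u\<parallel>\<^sup>2\<close>. Since the sample \<open>\<omega>\<^sub>m\<close> is independent of the iterate \<open>u\<^sup>(\<^sup>m\<^sup>)\<close>, Fubini's theorem turns
  the bound into a recursion for \<open>x\<^sub>m = E (\<delta>\<^sub>m\<^sup>2)\<close> (lemma \<open>expected_delta_sq_Suc_le\<close>).

  For \<open>h = u\<close> the recursion reads \<open>(m + 2)\<^sup>2 x\<^sub>m\<^sub>+\<^sub>1 \<le> (m + 1)\<^sup>2 x\<^sub>m + C\<close>, whence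
  \<open>x\<^sub>m \<le> C / (m + 1)\<close>. For general \<open>h\<close> the cross term is controlled by
  \<open>\<surd>x\<^sub>m \<parallel>u - h\<parallel>\<close>, and an induction on \<open>(m + 1) \<surd>x\<^sub>m\<close> gives the second estimate. Such elements
  \<open>h\<close> are dense in the orthogonal complement of the kernel, hence convergence there.

  These bounds speak of \<open>A2\<close>. They become statements on \<open>H_L^(1/2)\<close> because the functions
  \<open>\<omega> \<mapsto> (\<psi>\<^sub>k \<bullet> \<omega>) / \<surd>\<mu>\<^sub>k\<close> are orthonormal in \<open>L\<^sup>2(\<rho>)\<close>: the integral of \<open>(v \<bullet> \<omega>)\<^sup>2\<close> is \<open>L v \<bullet> v\<close>. Bessel's
  inequality for the function \<open>c\<close> gives \<open>A2 \<subseteq> H_L^(1/2)\<close> without increase of the norm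
  (lemma \<open>A2_rep_imp_HL_rep\<close>); the series \<open>\<Sum> c\<^sub>k (\<psi>\<^sub>k \<bullet> \<omega>) / \<surd>\<mu>\<^sub>k\<close>, which converges by completeness
  of \<open>L\<^sup>2(\<rho>)\<close>, gives the converse (lemma \<open>HL_rep_imp_A2_rep\<close>) and shows that the infimum defining
  the norm of \<open>A2\<close> is attained.
\<close>

section \<open>Square-integrable functions on a probability space\<close>

lemma (in prob_space) expectation_square_le:
  fixes f :: "'a \<Rightarrow> real"
  assumes "f \<in> borel_measurable M" "integrable M (\<lambda>x. (f x)\<^sup>2)"
  shows "(expectation f)\<^sup>2 \<le> expectation (\<lambda>x. (f x)\<^sup>2)"
proof -
  have "integrable M f"
    using assms by (rule square_integrable_imp_integrable)
  then show ?thesis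
    using variance_eq[OF _ assms(2)] variance_positive[of f] by simp
qed

text \<open>Fatou's lemma, in the form in which a uniform bound on Bochner integrals passes to an almost
  everywhere limit.\<close>

lemma integral_bound_AE_limit:
  fixes g :: "nat \<Rightarrow> 'a \<Rightarrow> real"
  assumes g: "\<And>n. integrable M (g n)" "\<And>n x. 0 \<le> g n x" "\<And>n. (LINT x|M. g n x) \<le> C"
    and f: "f \<in> borel_measurable M" "AE x in M. (\<lambda>n. g n x) \<longlonglongrightarrow> f x"
  shows "integrable M f" "(LINT x|M. f x) \<le> C"
proof -
  have C: "0 \<le> C"
    using Bochner_Integration.integral_nonneg[of M "g 0"] g(2) g(3)[of 0] by (meson order_trans)
  have f0: "AE x in M. 0 \<le> f x"
    using f(2) by eventually_elim (use g(2) in \<open>blast intro: LIMSEQ_le_const\<close>)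
  have "(\<integral>\<^sup>+x. ennreal (f x) \<partial>M) = (\<integral>\<^sup>+x. liminf (\<lambda>n. ennreal (g n x)) \<partial>M)"
  proof (rule nn_integral_cong_AE, use f(2) in eventually_elim)
    case (elim x)
    then have "(\<lambda>n. ennreal (g n x)) \<longlonglongrightarrow> ennreal (f x)"
      by (rule tendsto_ennrealI)
    then show ?case
      by (simp add: lim_imp_Liminf)
  qed
  also have "\<dots> \<le> liminf (\<lambda>n. \<integral>\<^sup>+x. ennreal (g n x) \<partial>M)"
    using g(1) by (intro nn_integral_liminf) auto
  also have "\<dots> \<le> limsup (\<lambda>n. \<integral>\<^sup>+x. ennreal (g n x) \<partial>M)"
    by (rule Liminf_le_Limsup) simp
  also have "\<dots> \<le> ennreal C"
    by (rule Limsup_bounded)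
      (use g in \<open>auto intro!: always_eventually simp: nn_integral_eq_integral ennreal_leI\<close>)
  finally have le: "(\<integral>\<^sup>+x. ennreal (f x) \<partial>M) \<le> ennreal C" .
  then show int: "integrable M f"
    using f f0 by (intro integrableI_nonneg) (auto simp: le_less_trans)
  show "(LINT x|M. f x) \<le> C"
    using le C f0 int by (simp add: nn_integral_eq_integral integral_nonneg_AE)
qed

text \<open>On a probability space a Cauchy sequence in \<open>L\<^sup>2\<close> is Cauchy in \<open>L\<^sup>1\<close>, so a subsequence converges
  almost everywhere; the Fatou-type bound transfers every \<open>L\<^sup>2\<close> estimate to the limit.\<close>

lemma (in prob_space) L2_complete:
  fixes f :: "nat \<Rightarrow> 'a \<Rightarrow> real"
  assumes f: "\<And>n. f n \<in> borel_measurable M" "\<And>n. integrable M (\<lambda>x. (f n x)\<^sup>2)"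
    and bound: "\<And>n. expectation (\<lambda>x. (f n x)\<^sup>2) \<le> C"
    and Cauchy: "\<And>e. e > 0 \<Longrightarrow> \<exists>N. \<forall>m\<ge>N. \<forall>n\<ge>N. expectation (\<lambda>x. (f m x - f n x)\<^sup>2) < e"
  obtains g where "g \<in> borel_measurable M" "integrable M (\<lambda>x. (g x)\<^sup>2)"
    "expectation (\<lambda>x. (g x)\<^sup>2) \<le> C"
    "(\<lambda>n. expectation (\<lambda>x. (f n x - g x)\<^sup>2)) \<longlonglongrightarrow> 0"
    "\<And>n. integrable M (\<lambda>x. (f n x - g x)\<^sup>2)"
proof -
  note [measurable] = f(1)
  have mult: "integrable M (\<lambda>x. f m x * f n x)" for m n
  proof (rule Bochner_Integration.integrable_bound)
    show "integrable M (\<lambda>x. (f m x)\<^sup>2 + (f n x)\<^sup>2)"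
      using f(2) by simp
    have "\<bar>a * b\<bar> \<le> a\<^sup>2 + b\<^sup>2" for a b :: real
      using sum_squares_bound[of "\<bar>a\<bar>" "\<bar>b\<bar>"] abs_ge_zero[of "a * b"]
      by (simp only: abs_mult power2_abs)
    then show "AE x in M. norm (f m x * f n x) \<le> norm ((f m x)\<^sup>2 + (f n x)\<^sup>2)"
      by (intro AE_I2) (simp only: real_norm_def abs_of_nonneg sum_power2_ge_zero)
  qed simp
  have diff: "integrable M (\<lambda>x. (f m x - f n x)\<^sup>2)" for m n
    using mult[of m n] f(2) by (simp add: power2_diff mult.assoc)
  have L1: "\<exists>N. \<forall>m\<ge>N. \<forall>n\<ge>N. expectation (\<lambda>x. norm (f m x - f n x)) < e" if e: "e > 0" for e
  proof -
    obtain N where N: "\<And>m n. m \<ge> N \<Longrightarrow> n \<ge> N \<Longrightarrow> expectation (\<lambda>x. (f m x - f n x)\<^sup>2) < e\<^sup>2"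
      using Cauchy[of "e\<^sup>2"] e by auto
    have "expectation (\<lambda>x. norm (f m x - f n x)) < e" if "m \<ge> N" "n \<ge> N" for m n
    proof -
      have "(expectation (\<lambda>x. norm (f m x - f n x)))\<^sup>2 \<le> expectation (\<lambda>x. (f m x - f n x)\<^sup>2)"
        using expectation_square_le[of "\<lambda>x. norm (f m x - f n x)"] diff[of m n] by simp
      then show ?thesis
        using N[OF that] e by (meson le_less_trans less_imp_le power_less_imp_less_base)
    qed
    then show ?thesis by blast
  qed
  have int: "integrable M (f n)" for n
    using f by (rule square_integrable_imp_integrable)
  obtain r where r: "strict_mono r" "AE x in M. Cauchy (\<lambda>i. f (r i) x)"
    using cauchy_L1_AE_cauchy_subseq[OF int L1] by blast
  define g where "g x = lim (\<lambda>i. f (r i) x)" for x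
  have [measurable]: "g \<in> borel_measurable M"
    unfolding g_def by measurable
  have lim: "AE x in M. (\<lambda>i. f (r i) x) \<longlonglongrightarrow> g x"
    using r(2) by eventually_elim (simp add: g_def Cauchy_convergent_iff convergent_LIMSEQ_iff)
  have g2: "integrable M (\<lambda>x. (g x)\<^sup>2)" "expectation (\<lambda>x. (g x)\<^sup>2) \<le> C"
  proof -
    have l: "AE x in M. (\<lambda>i. (f (r i) x)\<^sup>2) \<longlonglongrightarrow> (g x)\<^sup>2"
      using lim by eventually_elim (intro tendsto_intros)
    show "integrable M (\<lambda>x. (g x)\<^sup>2)" "expectation (\<lambda>x. (g x)\<^sup>2) \<le> C"
      using integral_bound_AE_limit[of M "\<lambda>i x. (f (r i) x)\<^sup>2", OF f(2) _ bound _ l] by simp_all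
  qed
  have close: "\<exists>N. \<forall>n\<ge>N. expectation (\<lambda>x. (f n x - g x)\<^sup>2) \<le> e" if e: "e > 0" for e
  proof -
    obtain N where N: "\<And>m n. m \<ge> N \<Longrightarrow> n \<ge> N \<Longrightarrow> expectation (\<lambda>x. (f m x - f n x)\<^sup>2) < e"
      using Cauchy[OF e] by auto
    have "expectation (\<lambda>x. (f n x - g x)\<^sup>2) \<le> e" if n: "n \<ge> N" for n
    proof -
      have l: "AE x in M. (\<lambda>i. (f n x - f (r (i + N)) x)\<^sup>2) \<longlonglongrightarrow> (f n x - g x)\<^sup>2"
        using lim by eventually_elim (intro tendsto_intros LIMSEQ_ignore_initial_segment)
      have "r (i + N) \<ge> N" for i
        using seq_suble[OF r(1), of "i + N"] by simp
      then have b: "expectation (\<lambda>x. (f n x - f (r (i + N)) x)\<^sup>2) \<le> e" for i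
        using N[OF n] less_imp_le by blast
      show ?thesis
        using integral_bound_AE_limit[of M "\<lambda>i x. (f n x - f (r (i + N)) x)\<^sup>2", OF diff _ b _ l] by simp
    qed
    then show ?thesis by blast
  qed
  have gd: "integrable M (\<lambda>x. (f n x - g x)\<^sup>2)" for n
  proof (rule Bochner_Integration.integrable_bound)
    show "integrable M (\<lambda>x. 2 * (f n x)\<^sup>2 + 2 * (g x)\<^sup>2)"
      using f(2) g2(1) by simp
    have "(a - b)\<^sup>2 \<le> 2 * a\<^sup>2 + 2 * b\<^sup>2" for a b :: real
      using zero_le_power2[of "a + b"] by (simp add: power2_eq_square algebra_simps)
    then show "AE x in M. norm ((f n x - g x)\<^sup>2) \<le> norm (2 * (f n x)\<^sup>2 + 2 * (g x)\<^sup>2)"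
      by (intro AE_I2) simp
  qed simp
  have "(\<lambda>n. expectation (\<lambda>x. (f n x - g x)\<^sup>2)) \<longlonglongrightarrow> 0"
  proof (rule LIMSEQ_I)
    fix e :: real assume "e > 0"
    then obtain N where "\<forall>n\<ge>N. expectation (\<lambda>x. (f n x - g x)\<^sup>2) \<le> e / 2"
      using close[of "e / 2"] by auto
    then show "\<exists>N. \<forall>n\<ge>N. norm (expectation (\<lambda>x. (f n x - g x)\<^sup>2) - 0) < e"
      using \<open>e > 0\<close> by (intro exI[of _ N]) (auto simp: abs_of_nonneg intro: le_less_trans)
  qed
  then show thesis
    using that[of g] g2 gd by simp
qed

section \<open>One step of the algorithm\<close>

lemma norm_sub_scaled_unit:
  fixes x w :: "'a::real_inner"
  assumes "norm w = 1"
  shows "(norm (x - s *\<^sub>R w))\<^sup>2 = (norm x)\<^sup>2 - (x \<bullet> w)\<^sup>2 + (s - x \<bullet> w)\<^sup>2"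
proof -
  have "w \<bullet> w = 1"
    using assms by (simp add: norm_eq_1)
  then show ?thesis
    unfolding power2_norm_eq_inner
    by (simp add: inner_diff_left inner_diff_right inner_commute[of w x] power2_eq_square algebra_simps)
qed

text \<open>The update after the line search has been carried out explicitly, with \<open>b = 1 - \<alpha>\<close>. The case
  distinction is forced: if the residual is orthogonal to \<open>w\<close>, the search direction vanishes and
  the component of \<open>u - (1 - b) v\<close> along \<open>w\<close> cannot be removed.\<close>

definition next_iterate :: "real \<Rightarrow> 'a::real_inner \<Rightarrow> 'a \<Rightarrow> 'a \<Rightarrow> 'a" where
  "next_iterate b u v w = (1 - b) *\<^sub>R v
     + (if (u - v) \<bullet> w = 0 then 0 else ((u - (1 - b) *\<^sub>R v) \<bullet> w) *\<^sub>R w)"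

lemma iter_Suc_eq_next_iterate:
  assumes w: "norm (w m) = 1"
  shows "iter u w (Suc m) = next_iterate (1 / (real m + 2)) u (iter u w m) (w m)"
proof -
  define v where "v = iter u w m"
  define t where "t = (u - v) \<bullet> w m"
  define x where "x = u - (1 - 1 / (real m + 2)) *\<^sub>R v"
  define f where "f \<xi> = (norm (x - (\<xi> * t) *\<^sub>R w m))\<^sup>2" for \<xi>
  define \<xi> where "\<xi> = arg_min f (\<lambda>_. True)"
  have f: "f z = (norm x)\<^sup>2 - (x \<bullet> w m)\<^sup>2 + (z * t - x \<bullet> w m)\<^sup>2" for z
    unfolding f_def by (rule norm_sub_scaled_unit[OF w])
  have it: "iter u w (Suc m) = (1 - 1 / (real m + 2)) *\<^sub>R v + (\<xi> * t) *\<^sub>R w m"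
    by (simp add: Let_def \<xi>_def f_def[abs_def] v_def x_def t_def)
  \<comment> \<open>The objective is a parabola in \<open>\<xi>\<close>, so for \<open>t \<noteq> 0\<close> its minimum exists and \<open>arg_min\<close> picks it.\<close>
  have "\<xi> * t = x \<bullet> w m" if t: "t \<noteq> 0"
  proof -
    have "is_arg_min f (\<lambda>_. True) ((x \<bullet> w m) / t)"
      unfolding is_arg_min_linorder using t by (simp add: f)
    then have "is_arg_min f (\<lambda>_. True) \<xi>"
      unfolding \<xi>_def arg_min_def by (rule someI)
    then have "f \<xi> \<le> f ((x \<bullet> w m) / t)"
      unfolding is_arg_min_linorder by simp
    then show ?thesis
      using t by (simp add: f)
  qed
  then show ?thesis
    unfolding it next_iterate_def v_def[symmetric] t_def[symmetric] x_def[symmetric] by simp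
qed

text \<open>Both cases of the update leave a vector no longer than \<open>(1 - b) (u - v) + b u\<close>, a convex
  combination of two vectors of norm at most \<open>norm u\<close>. This makes all iterates uniformly bounded,
  which settles every question of integrability over the samples.\<close>

lemma residual_next_iterate_le_norm:
  assumes w: "norm w = 1" and b: "0 \<le> b" "b \<le> 1" and v: "norm (u - v) \<le> norm u"
  shows "norm (u - next_iterate b u v w) \<le> norm u"
proof -
  define x where "x = u - (1 - b) *\<^sub>R v"
  have "norm (u - next_iterate b u v w) \<le> norm x"
  proof (cases "(u - v) \<bullet> w = 0")
    case True
    then show ?thesis by (simp add: next_iterate_def x_def)
  next
    case False
    then have "u - next_iterate b u v w = x - (x \<bullet> w) *\<^sub>R w"
      by (simp add: next_iterate_def x_def)
    then show ?thesis
      using norm_sub_scaled_unit[OF w, of x "x \<bullet> w"] by (simp add: norm_le_square flip: power2_norm_eq_inner)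
  qed
  also have "x = (1 - b) *\<^sub>R (u - v) + b *\<^sub>R u"
    by (simp add: x_def algebra_simps)
  also have "norm \<dots> \<le> (1 - b) * norm (u - v) + b * norm u"
    using b norm_triangle_ineq[of "(1 - b) *\<^sub>R (u - v)" "b *\<^sub>R u"] by simp
  also have "\<dots> \<le> (1 - b) * norm u + b * norm u"
    using v b by (intro add_mono mult_left_mono) auto
  finally show ?thesis by (simp add: algebra_simps)
qed

text \<open>The number \<open>c\<close> is free: it will be the value at \<open>w\<close> of a density representing some \<open>h\<close>. If
  \<open>u - v\<close> is not orthogonal to \<open>w\<close>, the update is at least as good as
  subtracting \<open>(b * c) w\<close> from \<open>u - (1 - b) v\<close>. Otherwise the bound exceeds the true value by
  \<open>b\<^sup>2 (\<parallel>u\<parallel>\<^sup>2 + c\<^sup>2 - 2 c (u \<bullet> w)) \<ge> b\<^sup>2 (c - u \<bullet> w)\<^sup>2\<close>; the second copy of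
  \<open>\<parallel>u\<parallel>\<^sup>2\<close> is there for this case.\<close>

lemma residual_next_iterate_sq_le:
  assumes w: "norm w = 1"
  shows "(norm (u - next_iterate b u v w))\<^sup>2 \<le> (1 - b)\<^sup>2 * (norm (u - v))\<^sup>2
      + 2 * (1 - b) * b * ((u - v) \<bullet> u - c * ((u - v) \<bullet> w))
      + b\<^sup>2 * (2 * (norm u)\<^sup>2 + c\<^sup>2 - 2 * (c * (u \<bullet> w)))"
    (is "_ \<le> ?R")
proof -
  define x where "x = u - (1 - b) *\<^sub>R v"
  have x: "x = (1 - b) *\<^sub>R (u - v) + b *\<^sub>R u"
    by (simp add: x_def algebra_simps)
  have xx: "(norm x)\<^sup>2 = (1 - b)\<^sup>2 * (norm (u - v))\<^sup>2 + 2 * (1 - b) * b * ((u - v) \<bullet> u) + b\<^sup>2 * (norm u)\<^sup>2"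
    unfolding power2_norm_eq_inner x inner_add_left inner_add_right inner_scaleR_left inner_scaleR_right
    by (simp only: inner_commute[of u "u - v"]) (simp add: power2_eq_square algebra_simps)
  have xw: "x \<bullet> w = (1 - b) * ((u - v) \<bullet> w) + b * (u \<bullet> w)"
    unfolding x by (simp add: inner_add_left)
  show ?thesis
  proof (cases "(u - v) \<bullet> w = 0")
    case True
    have "(u \<bullet> w)\<^sup>2 \<le> (norm u)\<^sup>2"
      using Cauchy_Schwarz_ineq2[of u w] w abs_le_square_iff[of "u \<bullet> w" "norm u"] by simp
    then have "0 \<le> (norm u)\<^sup>2 + c\<^sup>2 - 2 * (c * (u \<bullet> w))"
      using zero_le_power2[of "c - u \<bullet> w"] by (simp add: power2_diff)
    then have "0 \<le> b\<^sup>2 * ((norm u)\<^sup>2 + c\<^sup>2 - 2 * (c * (u \<bullet> w)))"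
      by simp
    moreover have "?R = (norm x)\<^sup>2 + b\<^sup>2 * ((norm u)\<^sup>2 + c\<^sup>2 - 2 * (c * (u \<bullet> w)))"
      unfolding xx True by (simp add: algebra_simps)
    moreover have "u - next_iterate b u v w = x"
      using True by (simp add: next_iterate_def x_def)
    ultimately show ?thesis by simp
  next
    case False
    then have "u - next_iterate b u v w = x - (x \<bullet> w) *\<^sub>R w"
      by (simp add: next_iterate_def x_def)
    then have "(norm (u - next_iterate b u v w))\<^sup>2 = (norm x)\<^sup>2 - (x \<bullet> w)\<^sup>2"
      using norm_sub_scaled_unit[OF w, of x "x \<bullet> w"] by simp
    also have "\<dots> \<le> (norm x)\<^sup>2 - (x \<bullet> w)\<^sup>2 + (b * c - x \<bullet> w)\<^sup>2 + b\<^sup>2 * (norm u)\<^sup>2"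
      by simp
    also have "\<dots> = ?R"
      unfolding xx xw by (simp add: power2_eq_square algebra_simps)
    finally show ?thesis .
  qed
qed

section \<open>The covariance operator and representations over the sphere\<close>

locale sphere_measure = prob_space \<rho>
  for \<rho> :: "'a::{real_inner, banach, second_countable_topology} measure" +
  assumes sets_eq: "sets \<rho> = sets (restrict_space borel (sphere 0 1))"
begin

lemma space_eq: "space \<rho> = sphere 0 1"
  using sets_eq_imp_space_eq[OF sets_eq] by (simp add: space_restrict_space)

lemma norm_on_sphere: "\<omega> \<in> space \<rho> \<Longrightarrow> norm \<omega> = 1"
  by (simp add: space_eq)

lemma measurable_ident_borel [measurable]: "(\<lambda>\<omega>. \<omega>) \<in> borel_measurable \<rho>"
  unfolding measurable_cong_sets[OF sets_eq refl] by (rule measurable_restrict_space1) simp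

lemma abs_inner_le: "\<omega> \<in> space \<rho> \<Longrightarrow> \<bar>v \<bullet> \<omega>\<bar> \<le> norm v"
  using Cauchy_Schwarz_ineq2[of v \<omega>] by (simp add: norm_on_sphere)

lemma integrable_cov: "integrable \<rho> (\<lambda>\<omega>. (v \<bullet> \<omega>) *\<^sub>R \<omega>)"
  by (rule integrable_const_bound[of _ "norm v"])
    (auto simp: norm_on_sphere abs_inner_le)

lemma integrable_inner_inner [simp]: "integrable \<rho> (\<lambda>\<omega>. (v \<bullet> \<omega>) * (w \<bullet> \<omega>))"
  and integral_inner_inner: "(LINT \<omega>|\<rho>. (v \<bullet> \<omega>) * (w \<bullet> \<omega>)) = cov_op \<rho> v \<bullet> w"
  using integrable_inner_right[OF integrable_cov, of w v]
    integral_inner_right[OF integrable_cov, of w v]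
  by (simp_all add: cov_op_def inner_commute[of _ w])

lemma integrable_inner_sq [simp]: "integrable \<rho> (\<lambda>\<omega>. (v \<bullet> \<omega>)\<^sup>2)"
  using integrable_inner_inner[of v v] by (simp add: power2_eq_square)

lemma integral_inner_sq: "(LINT \<omega>|\<rho>. (v \<bullet> \<omega>)\<^sup>2) = cov_op \<rho> v \<bullet> v"
  using integral_inner_inner[of v v] by (simp add: power2_eq_square)

lemma linear_cov_op: "linear (cov_op \<rho>)"
proof
  fix v w :: 'a and r :: real
  show "cov_op \<rho> (v + w) = cov_op \<rho> v + cov_op \<rho> w"
    unfolding cov_op_def inner_add_left scaleR_left.add
    using Bochner_Integration.integral_add[OF integrable_cov integrable_cov] .
  show "cov_op \<rho> (r *\<^sub>R v) = r *\<^sub>R cov_op \<rho> v"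
    unfolding cov_op_def by (simp flip: scaleR_scaleR)
qed

lemma A2_rep_inner:
  assumes "A2_rep \<rho> u c"
  shows "integrable \<rho> (\<lambda>\<omega>. c \<omega> * (v \<bullet> \<omega>))" "(LINT \<omega>|\<rho>. c \<omega> * (v \<bullet> \<omega>)) = v \<bullet> u"
  using assms integrable_inner_right[of v \<rho> "\<lambda>\<omega>. c \<omega> *\<^sub>R \<omega>"] integral_inner_right[of v \<rho> "\<lambda>\<omega>. c \<omega> *\<^sub>R \<omega>"]
  unfolding A2_rep_def by simp_all

text \<open>Expand \<open>\<integral> (c(\<omega>) - v \<bullet> \<omega>)\<^sup>2 d\<rho> \<ge> 0\<close>. Suitable choices of \<open>v\<close> yield the norm bound below, the
  orthogonality of \<open>u\<close> to the kernel of \<open>L\<close>, and Bessel's inequality.\<close>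

lemma A2_rep_quadratic_le:
  assumes c: "A2_rep \<rho> u c"
  shows "2 * (v \<bullet> u) - cov_op \<rho> v \<bullet> v \<le> (LINT \<omega>|\<rho>. (c \<omega>)\<^sup>2)"
proof -
  note [simp] = A2_rep_inner[OF c]
  have [simp]: "integrable \<rho> (\<lambda>\<omega>. (c \<omega>)\<^sup>2)"
    using c by (simp add: A2_rep_def)
  have "0 \<le> (LINT \<omega>|\<rho>. (c \<omega> - v \<bullet> \<omega>)\<^sup>2)" by simp
  also have "\<dots> = (LINT \<omega>|\<rho>. (c \<omega>)\<^sup>2 + (v \<bullet> \<omega>)\<^sup>2 - 2 * (c \<omega> * (v \<bullet> \<omega>)))"
    by (simp add: power2_diff mult.assoc)
  also have "\<dots> = (LINT \<omega>|\<rho>. (c \<omega>)\<^sup>2) + cov_op \<rho> v \<bullet> v - 2 * (v \<bullet> u)"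
    by (simp add: integral_inner_sq)
  finally show ?thesis by simp
qed

lemma cov_op_inner_le: "cov_op \<rho> v \<bullet> v \<le> (norm v)\<^sup>2"
proof -
  have "(v \<bullet> \<omega>)\<^sup>2 \<le> (norm v)\<^sup>2" if "\<omega> \<in> space \<rho>" for \<omega>
    using abs_inner_le[OF that, of v] abs_le_square_iff[of "v \<bullet> \<omega>" "norm v"] by simp
  then have "(LINT \<omega>|\<rho>. (v \<bullet> \<omega>)\<^sup>2) \<le> (LINT \<omega>|\<rho>. (norm v)\<^sup>2)"
    by (intro integral_mono) simp_all
  then show ?thesis
    by (simp add: integral_inner_sq prob_space)
qed

lemma A2_rep_norm_le:
  assumes "A2_rep \<rho> u c"
  shows "(norm u)\<^sup>2 \<le> (LINT \<omega>|\<rho>. (c \<omega>)\<^sup>2)"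
  using A2_rep_quadratic_le[OF assms, of u] cov_op_inner_le[of u] by (simp add: power2_norm_eq_inner)

lemma measurable_next_iterate:
  "case_prod (next_iterate b u) \<in> borel_measurable (borel \<Otimes>\<^sub>M \<rho>)"
  unfolding next_iterate_def case_prod_beta by measurable

end

section \<open>The expected error\<close>

context sphere_measure
begin

text \<open>Integration of the pointwise bound, where \<open>c\<close> enters linearly only through
  \<open>\<integral> c(\<omega>) (z \<bullet> \<omega>) d\<rho> = z \<bullet> h\<close>.\<close>

lemma integral_residual_next_iterate_sq_le:
  assumes c: "A2_rep \<rho> h c"
  shows "(LINT \<omega>|\<rho>. (norm (u - next_iterate b u v \<omega>))\<^sup>2)
    \<le> (1 - b)\<^sup>2 * (norm (u - v))\<^sup>2 + 2 * (1 - b) * b * ((u - v) \<bullet> (u - h))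
      + b\<^sup>2 * (2 * (norm u)\<^sup>2 + (LINT \<omega>|\<rho>. (c \<omega>)\<^sup>2) - 2 * (u \<bullet> h))"
proof -
  note [simp] = A2_rep_inner[OF c]
  have [simp]: "integrable \<rho> (\<lambda>\<omega>. (c \<omega>)\<^sup>2)"
    using c by (simp add: A2_rep_def)
  define R where "R \<omega> = (1 - b)\<^sup>2 * (norm (u - v))\<^sup>2
      + 2 * (1 - b) * b * ((u - v) \<bullet> u - c \<omega> * ((u - v) \<bullet> \<omega>))
      + b\<^sup>2 * (2 * (norm u)\<^sup>2 + (c \<omega>)\<^sup>2 - 2 * (c \<omega> * (u \<bullet> \<omega>)))" for \<omega>
  have le: "(norm (u - next_iterate b u v \<omega>))\<^sup>2 \<le> R \<omega>" if "\<omega> \<in> space \<rho>" for \<omega>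
    unfolding R_def by (rule residual_next_iterate_sq_le[OF norm_on_sphere[OF that]])
  have "(LINT \<omega>|\<rho>. (norm (u - next_iterate b u v \<omega>))\<^sup>2) \<le> (LINT \<omega>|\<rho>. R \<omega>)"
  proof (rule integral_mono')
    show "integrable \<rho> R"
      unfolding R_def by (intro Bochner_Integration.integrable_add Bochner_Integration.integrable_mult_right Bochner_Integration.integrable_diff integrable_const) simp_all
    show "0 \<le> R \<omega>" if "\<omega> \<in> space \<rho>" for \<omega>
      using zero_le_power2 le[OF that] by (rule order_trans)
  qed (rule le)
  also have "\<dots> = (1 - b)\<^sup>2 * (norm (u - v))\<^sup>2 + 2 * (1 - b) * b * ((u - v) \<bullet> u - (u - v) \<bullet> h)
      + b\<^sup>2 * (2 * (norm u)\<^sup>2 + (LINT \<omega>|\<rho>. (c \<omega>)\<^sup>2) - 2 * (u \<bullet> h))"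
    unfolding R_def by (simp add: prob_space)
  finally show ?thesis
    by (simp only: inner_diff_right)
qed

text \<open>The index set is a parameter so that the induction can stay in one product space; for
  \<open>I = {..<m}\<close> the lemma shows that the iterate is a measurable function of the first \<open>m\<close> samples alone.\<close>

lemma measurable_iter:
  assumes "{..<m} \<subseteq> I"
  shows "(\<lambda>w. iter u w m) \<in> borel_measurable (PiM I (\<lambda>_. \<rho>))"
  using assms
proof (induction m)
  case 0
  show ?case by simp
next
  case (Suc m)
  have "m \<in> I" and "{..<m} \<subseteq> I" using Suc.prems by auto
  then have 1: "(\<lambda>w. (iter u w m, w m)) \<in> measurable (PiM I (\<lambda>_. \<rho>)) (borel \<Otimes>\<^sub>M \<rho>)"
    using Suc.IH by (intro measurable_Pair measurable_component_singleton) auto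
  have "(\<lambda>w. next_iterate (1 / (real m + 2)) u (iter u w m) (w m)) \<in> borel_measurable (PiM I (\<lambda>_. \<rho>))"
    using measurable_compose[OF 1 measurable_next_iterate] by simp
  moreover have "w m \<in> space \<rho>" if "w \<in> space (PiM I (\<lambda>_. \<rho>))" for w
    using that \<open>m \<in> I\<close> by (auto simp: space_PiM)
  ultimately show ?case
    by (subst measurable_cong[OF iter_Suc_eq_next_iterate]) (auto dest: norm_on_sphere)
qed

end

lemma iter_cong:
  assumes "\<And>i. i < m \<Longrightarrow> w i = w' i"
  shows "iter u w m = iter u w' m"
  using assms by (induction m) (simp_all add: Let_def)

text \<open>A conditional bound given \<open>X\<close> may be integrated over \<open>X\<close>: the joint law of independent
  variables is the product of their laws, so Fubini's theorem applies.\<close>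

lemma (in prob_space) expectation_indep_le:
  fixes F :: "'b \<times> 'b \<Rightarrow> real" and X Y :: "'a \<Rightarrow> 'b"
  assumes ind: "indep_var S X T Y"
    and F: "F \<in> borel_measurable (S \<Otimes>\<^sub>M T)" "integrable M (\<lambda>x. F (X x, Y x))"
    and G: "G \<in> borel_measurable S" "integrable M (\<lambda>x. G (X x))"
    and le: "\<And>v. (LINT w|distr M T Y. F (v, w)) \<le> G v"
  shows "expectation (\<lambda>x. F (X x, Y x)) \<le> expectation (\<lambda>x. G (X x))"
proof -
  have X: "X \<in> measurable M S" and Y: "Y \<in> measurable M T"
    and eq: "distr M S X \<Otimes>\<^sub>M distr M T Y = distr M (S \<Otimes>\<^sub>M T) (\<lambda>x. (X x, Y x))"
    using ind unfolding indep_var_distribution_eq by auto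
  interpret X: prob_space "distr M S X" by (rule prob_space_distr[OF X])
  interpret Y: prob_space "distr M T Y" by (rule prob_space_distr[OF Y])
  interpret pair_sigma_finite "distr M S X" "distr M T Y" ..
  have XY: "(\<lambda>x. (X x, Y x)) \<in> measurable M (S \<Otimes>\<^sub>M T)"
    using X Y by (rule measurable_Pair)
  have int: "integrable (distr M S X \<Otimes>\<^sub>M distr M T Y) F"
    unfolding eq using F XY by (simp add: integrable_distr_eq)
  have "expectation (\<lambda>x. F (X x, Y x)) = (LINT z|(distr M S X \<Otimes>\<^sub>M distr M T Y). F z)"
    unfolding eq using F XY by (simp add: integral_distr)
  also have "\<dots> = (LINT v|distr M S X. LINT w|distr M T Y. F (v, w))"
    using integral_fst'[OF int] by simp
  also have "\<dots> \<le> (LINT v|distr M S X. G v)"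
    using integrable_fst'[OF int] G X le by (intro integral_mono) (simp_all add: integrable_distr_eq)
  also have "\<dots> = expectation (\<lambda>x. G (X x))"
    using G X by (simp add: integral_distr)
  finally show ?thesis .
qed

locale iid_sphere_samples = sphere_measure \<rho> + M: prob_space M
  for \<rho> :: "'a::{real_inner, banach, second_countable_topology} measure" and M :: "'b measure" +
  fixes W :: "nat \<Rightarrow> 'b \<Rightarrow> 'a"
  assumes indep: "M.indep_vars (\<lambda>_. \<rho>) W UNIV"
    and distr_eq: "distr M \<rho> (W i) = \<rho>"
begin

abbreviation iterate :: "'a \<Rightarrow> nat \<Rightarrow> 'b \<Rightarrow> 'a" where
  "iterate u m x \<equiv> iter u (\<lambda>i. W i x) m"

lemma measurable_sample [measurable]: "W i \<in> measurable M \<rho>"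
  using indep by (simp add: M.indep_vars_def)

lemma norm_sample: "x \<in> space M \<Longrightarrow> norm (W i x) = 1"
  using measurable_space[OF measurable_sample] norm_on_sphere by blast

lemma measurable_iterate [measurable]: "iterate u m \<in> borel_measurable M"
proof -
  have "(\<lambda>x i. W i x) \<in> measurable M (PiM UNIV (\<lambda>_. \<rho>))"
    by (rule measurable_PiM_single') (auto simp: space_PiM intro: measurable_space[OF measurable_sample])
  then show ?thesis
    using measurable_compose measurable_iter[of m UNIV u] by fastforce
qed

text \<open>The iterate depends on the samples with index below \<open>m\<close> only.\<close>

lemma indep_iterate_sample: "M.indep_var borel (iterate u m) \<rho> (W m)"
proof -
  have "M.indep_var (PiM {..<m} (\<lambda>_. \<rho>)) (\<lambda>x. restrict (\<lambda>i. W i x) {..<m})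
      (PiM {m} (\<lambda>_. \<rho>)) (\<lambda>x. restrict (\<lambda>i. W i x) {m})"
    by (rule M.indep_var_restrict[OF indep]) auto
  from M.indep_var_compose[OF this measurable_iter[OF order_refl] measurable_component_singleton]
  have "M.indep_var borel ((\<lambda>w. iter u w m) \<circ> (\<lambda>x. restrict (\<lambda>i. W i x) {..<m}))
      \<rho> ((\<lambda>w. w m) \<circ> (\<lambda>x. restrict (\<lambda>i. W i x) {m}))"
    by simp
  moreover have "(\<lambda>w. iter u w m) \<circ> (\<lambda>x. restrict (\<lambda>i. W i x) {..<m}) = iterate u m"
    by (intro ext) (auto intro: iter_cong)
  moreover have "(\<lambda>w. w m) \<circ> (\<lambda>x. restrict (\<lambda>i. W i x) {m}) = W m"
    by auto
  ultimately show ?thesis by simp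
qed

lemma residual_le_norm:
  assumes "x \<in> space M"
  shows "norm (u - iterate u m x) \<le> norm u"
proof (induction m)
  case (Suc m)
  show ?case
    unfolding iter_Suc_eq_next_iterate[where w="\<lambda>i. W i x", OF norm_sample[OF assms]]
    by (rule residual_next_iterate_le_norm[OF norm_sample[OF assms] _ _ Suc]) auto
qed simp

lemma integrable_residual_sq: "integrable M (\<lambda>x. (norm (u - iterate u m x))\<^sup>2)"
  using residual_le_norm[of _ u m]
  by (intro M.integrable_const_bound[of _ "(norm u)\<^sup>2"]) (auto intro: power_mono)

lemma integrable_residual_inner: "integrable M (\<lambda>x. (u - iterate u m x) \<bullet> z)"
  using residual_le_norm[of _ u m]
  by (intro M.integrable_const_bound[of _ "norm u * norm z"])
    (auto intro!: order_trans[OF Cauchy_Schwarz_ineq2] mult_right_mono)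

lemma expected_delta_sq_nonneg: "0 \<le> expected_delta_sq M W u m"
  unfolding expected_delta_sq_def delta_sq_def by simp

lemma expected_delta_sq_0: "expected_delta_sq M W u 0 = (norm u)\<^sup>2"
  unfolding expected_delta_sq_def delta_sq_def by (simp add: M.prob_space)

text \<open>Cauchy-Schwarz in the space, then in \<open>L\<^sup>2\<close> over the samples.\<close>

lemma expectation_residual_inner_le:
  "(LINT x|M. (u - iterate u m x) \<bullet> z) \<le> sqrt (expected_delta_sq M W u m) * norm z"
proof -
  have i: "integrable M (\<lambda>x. norm (u - iterate u m x))"
    using integrable_residual_sq by (rule M.square_integrable_imp_integrable[rotated]) simp
  have "(LINT x|M. (u - iterate u m x) \<bullet> z) \<le> (LINT x|M. norm (u - iterate u m x) * norm z)"
    using integrable_residual_inner i by (intro integral_mono norm_cauchy_schwarz) simp_all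
  also have "\<dots> = (LINT x|M. norm (u - iterate u m x)) * norm z"
    by simp
  also have "(LINT x|M. norm (u - iterate u m x)) \<le> sqrt (expected_delta_sq M W u m)"
    unfolding expected_delta_sq_def delta_sq_def
    by (intro real_le_rsqrt M.expectation_square_le integrable_residual_sq) simp
  finally show ?thesis by (simp add: mult_right_mono)
qed

lemma expected_delta_sq_Suc_le:
  fixes u :: 'a and m :: nat
  assumes c: "A2_rep \<rho> h c"
  defines "b \<equiv> 1 / (real m + 2)"
  shows "expected_delta_sq M W u (Suc m) \<le> (1 - b)\<^sup>2 * expected_delta_sq M W u m
    + 2 * (1 - b) * b * (sqrt (expected_delta_sq M W u m) * norm (u - h))
    + b\<^sup>2 * (2 * (norm u)\<^sup>2 + (LINT \<omega>|\<rho>. (c \<omega>)\<^sup>2) - 2 * (u \<bullet> h))"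
proof -
  have b: "0 \<le> b" "b \<le> 1" by (simp_all add: b_def)
  define Q where "Q = 2 * (norm u)\<^sup>2 + (LINT \<omega>|\<rho>. (c \<omega>)\<^sup>2) - 2 * (u \<bullet> h)"
  define F where "F = (\<lambda>(v, w). (norm (u - next_iterate b u v w))\<^sup>2)"
  define G where "G v = (1 - b)\<^sup>2 * (norm (u - v))\<^sup>2 + 2 * (1 - b) * b * ((u - v) \<bullet> (u - h)) + b\<^sup>2 * Q" for v
  \<comment> \<open>\<open>F\<close> is the squared residual as a function of the old iterate and the new sample, \<open>G\<close> the
    bound on its conditional expectation.\<close>
  have F: "(norm (u - iterate u (Suc m) x))\<^sup>2 = F (iterate u m x, W m x)" if "x \<in> space M" for x
    using iter_Suc_eq_next_iterate[where w="\<lambda>i. W i x", OF norm_sample[OF that]]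
    by (simp only: F_def b_def case_prod_conv)
  have "expected_delta_sq M W u (Suc m) = (LINT x|M. F (iterate u m x, W m x))"
    unfolding expected_delta_sq_def delta_sq_def by (rule Bochner_Integration.integral_cong[OF refl F])
  also have "\<dots> \<le> (LINT x|M. G (iterate u m x))"
  proof (rule M.expectation_indep_le[OF indep_iterate_sample])
    show "F \<in> borel_measurable (borel \<Otimes>\<^sub>M \<rho>)"
    proof -
      note [measurable] = measurable_next_iterate[of b u]
      have "F = (\<lambda>z. (norm (u - case_prod (next_iterate b u) z))\<^sup>2)"
        by (auto simp: F_def)
      then show ?thesis by simp
    qed
    show "integrable M (\<lambda>x. F (iterate u m x, W m x))"
      by (rule Bochner_Integration.integrable_cong[OF refl F, THEN iffD1, OF _ integrable_residual_sq])
    show "G \<in> borel_measurable borel"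
      unfolding G_def by measurable
    show "integrable M (\<lambda>x. G (iterate u m x))"
      unfolding G_def
      by (intro Bochner_Integration.integrable_add Bochner_Integration.integrable_mult_right integrable_residual_sq integrable_residual_inner M.integrable_const)
    show "(LINT w|distr M \<rho> (W m). F (v, w)) \<le> G v" for v
      unfolding distr_eq F_def G_def Q_def case_prod_conv by (rule integral_residual_next_iterate_sq_le[OF c])
  qed
  also have "\<dots> = (1 - b)\<^sup>2 * expected_delta_sq M W u m
      + 2 * (1 - b) * b * (LINT x|M. (u - iterate u m x) \<bullet> (u - h)) + b\<^sup>2 * Q"
    unfolding G_def expected_delta_sq_def delta_sq_def
    using integrable_residual_sq integrable_residual_inner by (simp add: M.prob_space)
  also have "\<dots> \<le> (1 - b)\<^sup>2 * expected_delta_sq M W u m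
    + 2 * (1 - b) * b * (sqrt (expected_delta_sq M W u m) * norm (u - h)) + b\<^sup>2 * Q"
    using b by (intro add_mono mult_left_mono order_refl expectation_residual_inner_le) simp_all
  finally show ?thesis unfolding Q_def .
qed

lemma expected_delta_sq_le_of_A2:
  assumes c: "A2_rep \<rho> u c"
  shows "expected_delta_sq M W u m \<le> (LINT \<omega>|\<rho>. (c \<omega>)\<^sup>2) / (real m + 1)"
proof (induction m)
  case 0
  show ?case using A2_rep_norm_le[OF c] by (simp add: expected_delta_sq_0)
next
  case (Suc m)
  define C where "C = (LINT \<omega>|\<rho>. (c \<omega>)\<^sup>2)"
  have b: "1 - 1 / (real m + 2) = (real m + 1) / (real m + 2)"
    by (simp add: field_simps)
  have "expected_delta_sq M W u (Suc m)
      \<le> ((real m + 1) / (real m + 2))\<^sup>2 * expected_delta_sq M W u m + (1 / (real m + 2))\<^sup>2 * C"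
    using expected_delta_sq_Suc_le[OF c, of u m] unfolding b C_def by (simp add: power2_norm_eq_inner)
  also have "\<dots> \<le> ((real m + 1) / (real m + 2))\<^sup>2 * (C / (real m + 1)) + (1 / (real m + 2))\<^sup>2 * C"
    using Suc by (intro add_mono mult_left_mono) (simp_all add: C_def)
  also have "\<dots> = C / (real (Suc m) + 1)"
    by (simp add: divide_simps power2_eq_square) (simp add: algebra_simps)
  finally show ?case unfolding C_def .
qed

text \<open>With \<open>D = \<parallel>u - h\<parallel>\<close>, \<open>B = C + \<parallel>u\<parallel>\<^sup>2\<close>, \<open>n = m + 1\<close> and \<open>z = n \<surd>x\<^sub>m\<close> the recursion becomes
  \<open>(n + 1)\<^sup>2 x\<^sub>m\<^sub>+\<^sub>1 \<le> z\<^sup>2 + 2 z D + 4 B\<close>. The claim \<open>z \<le> 2 (n D + \<surd>(n B))\<close> is inductive because the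
  term \<open>4 n B\<close> in the square of its right-hand side grows by \<open>4 B\<close> in one step, and the terms with
  \<open>D\<close> grow enough to absorb \<open>2 z D\<close>.\<close>

lemma sqrt_expected_delta_sq_le_of_A2:
  assumes c: "A2_rep \<rho> h c"
  defines "C \<equiv> LINT \<omega>|\<rho>. (c \<omega>)\<^sup>2"
  shows "sqrt (expected_delta_sq M W u m)
    \<le> 2 * (norm (u - h) + sqrt (C + (norm u)\<^sup>2) / sqrt (real m + 1))"
proof -
  define x where "x m = expected_delta_sq M W u m" for m
  define D where "D = norm (u - h)"
  define B where "B = C + (norm u)\<^sup>2"
  have D: "0 \<le> D" and C: "0 \<le> C" by (simp_all add: D_def C_def)
  then have B: "0 \<le> B" by (simp add: B_def)
  have x0: "0 \<le> x m" for m unfolding x_def by (rule expected_delta_sq_nonneg)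
  \<comment> \<open>The factor 4 is exactly the growth per step that the induction can absorb.\<close>
  have Q: "2 * (norm u)\<^sup>2 + C - 2 * (u \<bullet> h) \<le> 4 * B"
  proof -
    have "0 \<le> (norm (u + h))\<^sup>2" by simp
    then have "- 2 * (u \<bullet> h) \<le> (norm u)\<^sup>2 + (norm h)\<^sup>2"
      by (simp add: power2_norm_eq_inner inner_add_left inner_add_right inner_commute[of h u])
    then show ?thesis
      using A2_rep_norm_le[OF c] C zero_le_power2[of "norm u"] unfolding B_def C_def[symmetric] by argo
  qed
  have rec: "(real m + 2)\<^sup>2 * x (Suc m)
      \<le> (real m + 1)\<^sup>2 * x m + 2 * (real m + 1) * sqrt (x m) * D + 4 * B" for m
  proof -
    have b: "1 - 1 / (real m + 2) = (real m + 1) / (real m + 2)"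
      by (simp add: field_simps)
    have "x (Suc m) \<le> ((real m + 1) / (real m + 2))\<^sup>2 * x m
        + 2 * ((real m + 1) / (real m + 2)) * (1 / (real m + 2)) * (sqrt (x m) * D)
        + (1 / (real m + 2))\<^sup>2 * (2 * (norm u)\<^sup>2 + C - 2 * (u \<bullet> h))"
      using expected_delta_sq_Suc_le[OF c, of u m] unfolding b x_def C_def D_def .
    also have "\<dots> \<le> ((real m + 1) / (real m + 2))\<^sup>2 * x m
        + 2 * ((real m + 1) / (real m + 2)) * (1 / (real m + 2)) * (sqrt (x m) * D)
        + (1 / (real m + 2))\<^sup>2 * (4 * B)"
      using Q by (intro add_mono mult_left_mono order_refl) auto
    also have "\<dots> = ((real m + 1)\<^sup>2 * x m + 2 * (real m + 1) * sqrt (x m) * D + 4 * B) / (real m + 2)\<^sup>2"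
    proof -
      have "(p / q)\<^sup>2 * y + 2 * (p / q) * (1 / q) * (s * D) + (1 / q)\<^sup>2 * (4 * B)
          = (p\<^sup>2 * y + 2 * p * s * D + 4 * B) / q\<^sup>2" for p q y s :: real
        by (simp add: power2_eq_square add_divide_distrib mult_ac)
      then show ?thesis .
    qed
    finally show ?thesis
      by (simp add: pos_le_divide_eq mult.commute)
  qed
  have "(real m + 1) * sqrt (x m) \<le> 2 * ((real m + 1) * D + sqrt (real m + 1) * sqrt B)"
  proof (induction m)
    case 0
    have "norm u \<le> sqrt B"
      using C by (intro real_le_rsqrt) (simp add: B_def)
    moreover have "sqrt B \<le> 2 * (D + sqrt B)"
      using D B by simp
    ultimately have "norm u \<le> 2 * (D + sqrt B)"
      by (rule order_trans)
    then show ?case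
      by (simp add: x_def expected_delta_sq_0)
  next
    case (Suc m)
    define n where "n = real m + 1"
    define s where "s = sqrt n * sqrt B"
    define s' where "s' = sqrt (n + 1) * sqrt B"
    define z where "z = n * sqrt (x m)"
    have n: "n \<ge> 1" by (simp add: n_def)
    have s: "0 \<le> s" "s \<le> s'" "s\<^sup>2 = n * B" "s'\<^sup>2 = (n + 1) * B"
      using n B by (auto simp: s_def s'_def power_mult_distrib mult_right_mono)
    have z: "0 \<le> z" "z \<le> 2 * (n * D + s)"
      using Suc x0[of m] n by (auto simp: z_def n_def s_def)
    have zz: "z\<^sup>2 = n\<^sup>2 * x m"
      using x0[of m] by (simp add: z_def power_mult_distrib)
    have "((n + 1) * sqrt (x (Suc m)))\<^sup>2 = (n + 1)\<^sup>2 * x (Suc m)"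
      using x0[of "Suc m"] by (simp add: power_mult_distrib)
    also have "\<dots> \<le> z\<^sup>2 + 2 * z * D + 4 * B"
    proof -
      have "n + 1 = real m + 2" "n = real m + 1" by (simp_all add: n_def)
      then have "(n + 1)\<^sup>2 * x (Suc m) \<le> n\<^sup>2 * x m + 2 * n * sqrt (x m) * D + 4 * B"
        using rec[of m] by (simp only:)
      then show ?thesis
        unfolding zz by (simp only: z_def mult.assoc)
    qed
    also have "\<dots> \<le> (2 * (n * D + s))\<^sup>2 + 2 * (2 * (n * D + s)) * D + 4 * B"
      using z D B by (intro add_mono power_mono mult_right_mono) auto
    also have "\<dots> = 4 * (n\<^sup>2 * D\<^sup>2 + n * D\<^sup>2) + 8 * (n * D * s) + 4 * D * s + 4 * ((n + 1) * B)"
      using s(3) by (simp add: power2_eq_square algebra_simps)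
    also have "\<dots> \<le> 4 * ((n + 1)\<^sup>2 * D\<^sup>2) + 8 * ((n + 1) * D * s') + 4 * ((n + 1) * B)"
    proof -
      have lin: "4 * (N + M) + 8 * P + 4 * T + R \<le> 4 * (N + 2 * M + d) + 8 * (P' + T') + R"
        if "P \<le> P'" "T \<le> T'" "0 \<le> T'" "0 \<le> d" "0 \<le> M" for N M P P' T T' R d :: real
        using that by (simp add: algebra_simps)
      have eqs: "(n + 1)\<^sup>2 * D\<^sup>2 = n\<^sup>2 * D\<^sup>2 + 2 * (n * D\<^sup>2) + D\<^sup>2"
        "(n + 1) * D * s' = n * D * s' + D * s'" "4 * D * s = 4 * (D * s)"
        by (simp_all add: power2_eq_square algebra_simps)
      show ?thesis
        unfolding eqs by (rule lin) (use s n D in \<open>simp_all add: mult_left_mono\<close>)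
    qed
    also have "\<dots> = (2 * ((n + 1) * D + s'))\<^sup>2"
      using s(4) by (simp add: power2_eq_square algebra_simps)
    finally have "(n + 1) * sqrt (x (Suc m)) \<le> 2 * ((n + 1) * D + s')"
      by (rule power2_le_imp_le) (use D s n in simp)
    then show ?case
      by (simp add: n_def s'_def add.commute)
  qed
  then have "sqrt (x m) \<le> 2 * ((real m + 1) * D + sqrt (real m + 1) * sqrt B) / (real m + 1)"
    by (simp add: pos_le_divide_eq mult.commute)
  also have "\<dots> = 2 * (D + sqrt B / sqrt (real m + 1))"
  proof -
    define q where "q = sqrt (real m + 1)"
    have "q > 0" and q: "real m + 1 = q * q"
      by (simp_all add: q_def)
    then show ?thesis
      unfolding q_def[symmetric] q by (simp add: field_simps)
  qed
  finally show ?thesis unfolding x_def D_def B_def .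
qed

end

section \<open>Orthonormal expansions\<close>

lemma orthonormal_inner_sum:
  fixes \<psi> :: "'k \<Rightarrow> 'a::real_inner"
  assumes on: "\<forall>j\<in>K. \<forall>k\<in>K. \<psi> j \<bullet> \<psi> k = (if j = k then 1 else 0)"
    and F: "finite F" "F \<subseteq> K"
  shows "(\<Sum>k\<in>F. a k *\<^sub>R \<psi> k) \<bullet> (\<Sum>k\<in>F. b k *\<^sub>R \<psi> k) = (\<Sum>k\<in>F. a k * b k)"
proof -
  have on_F: "\<psi> j \<bullet> \<psi> k = (if j = k then 1 else 0)" if "j \<in> F" "k \<in> F" for j k
    using on F(2) that by (meson subsetD)
  have "(\<Sum>j\<in>F. a j *\<^sub>R \<psi> j) \<bullet> (\<Sum>k\<in>F. b k *\<^sub>R \<psi> k)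
      = (\<Sum>j\<in>F. \<Sum>k\<in>F. a j * (b k * (\<psi> j \<bullet> \<psi> k)))"
    by (simp only: inner_sum_left) (simp only: inner_sum_right inner_scaleR_left inner_scaleR_right mult.left_commute)
  also have "\<dots> = (\<Sum>j\<in>F. \<Sum>k\<in>F. if j = k then a j * b j else 0)"
    by (intro sum.cong refl) (simp add: on_F)
  also have "\<dots> = (\<Sum>k\<in>F. a k * b k)"
    using F by simp
  finally show ?thesis .
qed

text \<open>The partial sum over a finite set \<open>Y\<close> is the orthogonal projection onto the span of
  \<open>\<psi> ` Y\<close>, hence at least as close to \<open>v\<close> as any given approximant from that span.\<close>

lemma has_sum_orthonormal_expansion:
  fixes \<psi> :: "'k \<Rightarrow> 'a::real_inner"
  assumes on: "\<forall>j\<in>K. \<forall>k\<in>K. \<psi> j \<bullet> \<psi> k = (if j = k then 1 else 0)"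
    and v: "v \<in> closure (span (\<psi> ` K))"
  shows "((\<lambda>k. (v \<bullet> \<psi> k) *\<^sub>R \<psi> k) has_sum v) K"
  unfolding has_sum_def tendsto_iff
proof (intro allI impI)
  fix e :: real assume "e > 0"
  then obtain y where y: "y \<in> span (\<psi> ` K)" "dist y v < e"
    using v unfolding closure_approachable by blast
  obtain t r where t: "finite t" "t \<subseteq> \<psi> ` K" "y = (\<Sum>a\<in>t. r a *\<^sub>R a)"
    using y(1) unfolding span_explicit by blast
  obtain F where F: "F \<subseteq> K" "finite F" "t = \<psi> ` F"
    using finite_subset_image[OF t(1,2)] by blast
  have "dist (\<Sum>k\<in>Y. (v \<bullet> \<psi> k) *\<^sub>R \<psi> k) v < e" if Y: "finite Y" "F \<subseteq> Y" "Y \<subseteq> K" for Y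
  proof -
    define p where "p = (\<Sum>k\<in>Y. (v \<bullet> \<psi> k) *\<^sub>R \<psi> k)"
    have orth_Y: "(v - p) \<bullet> \<psi> j = 0" if "j \<in> Y" for j
    proof -
      have "p \<bullet> \<psi> j = (\<Sum>k\<in>Y. if k = j then v \<bullet> \<psi> j else 0)"
        unfolding p_def inner_sum_left
      proof (rule sum.cong[OF refl])
        fix k assume "k \<in> Y"
        then show "((v \<bullet> \<psi> k) *\<^sub>R \<psi> k) \<bullet> \<psi> j = (if k = j then v \<bullet> \<psi> j else 0)"
        proof -
          have "\<psi> k \<bullet> \<psi> j = (if k = j then 1 else 0)"
            using on \<open>k \<in> Y\<close> Y(3) that by (meson subsetD)
          then show ?thesis by simp
        qed
      qed
      then show ?thesis
        using Y that by (simp add: inner_diff_left)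
    qed
    have orth: "(v - p) \<bullet> z = 0" if "z \<in> span (\<psi> ` Y)" for z
      using that
    proof (induction rule: span_induct_alt)
      case base
      show ?case by (rule inner_zero_right)
    next
      case (step c x y)
      obtain j where j: "j \<in> Y" "x = \<psi> j"
        using step(1) by (rule imageE)
      show ?case
        unfolding inner_add_right inner_scaleR_right j(2) orth_Y[OF j(1)] step(2) by simp
    qed
    have "y \<in> span (\<psi> ` Y)"
      unfolding t(3) F(3) using Y by (intro span_sum span_scale span_base) auto
    moreover have "p \<in> span (\<psi> ` Y)"
      unfolding p_def by (intro span_sum span_scale span_base) auto
    ultimately have "(v - p) \<bullet> (p - y) = 0"
      by (intro orth span_diff)
    then have "(norm (v - y))\<^sup>2 = (norm (v - p))\<^sup>2 + (norm (p - y))\<^sup>2"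
      using norm_add_Pythagorean[of "v - p" "p - y"] by (simp add: orthogonal_def)
    then have "(norm (v - p))\<^sup>2 \<le> (norm (v - y))\<^sup>2"
      by (simp only: le_add_same_cancel1 zero_le_power2)
    then have "norm (v - p) \<le> norm (v - y)"
      by (rule power2_le_imp_le) (rule norm_ge_zero)
    then show ?thesis
      using y(2) unfolding p_def[symmetric] by (simp add: dist_norm norm_minus_commute)
  qed
  then show "\<forall>\<^sub>F Y in finite_subsets_at_top K. dist (\<Sum>k\<in>Y. (v \<bullet> \<psi> k) *\<^sub>R \<psi> k) v < e"
    unfolding eventually_finite_subsets_at_top using F by blast
qed

lemma has_sum_imp_initial_sums_tendsto:
  fixes K :: "nat set"
  assumes "(f has_sum s) K"
  shows "(\<lambda>n. \<Sum>k\<in>K \<inter> {..<n}. f k) \<longlonglongrightarrow> s"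
proof -
  have "filterlim (\<lambda>n. K \<inter> {..<n}) (finite_subsets_at_top K) sequentially"
    unfolding filterlim_finite_subsets_at_top
  proof (intro allI impI)
    fix X assume X: "finite X \<and> X \<subseteq> K"
    then obtain N where "X \<subseteq> {..<N}"
      using finite_nat_iff_bounded by blast
    then show "\<forall>\<^sub>F n in sequentially. finite (K \<inter> {..<n}) \<and> X \<subseteq> K \<inter> {..<n} \<and> K \<inter> {..<n} \<subseteq> K"
      using X by (intro eventually_sequentiallyI[of N]) force
  qed
  then show ?thesis
    using assms unfolding has_sum_def by (rule filterlim_compose[rotated])
qed

section \<open>The classes coincide\<close>

locale covariance_eigensystem = sphere_measure \<rho>
  for \<rho> :: "'a::{real_inner, banach, second_countable_topology} measure" +
  fixes K :: "nat set" and \<psi> :: "nat \<Rightarrow> 'a" and \<mu> :: "nat \<Rightarrow> real"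
  assumes eigensystem: "eigensystem \<rho> K \<psi> \<mu>"
begin

lemma orthonormal: "\<forall>j\<in>K. \<forall>k\<in>K. \<psi> j \<bullet> \<psi> k = (if j = k then 1 else 0)"
  and eigenvalue_pos: "k \<in> K \<Longrightarrow> \<mu> k > 0"
  and cov_op_eigenvector: "k \<in> K \<Longrightarrow> cov_op \<rho> (\<psi> k) = \<mu> k *\<^sub>R \<psi> k"
  and closure_span_eq: "closure (span (\<psi> ` K)) = H_tilde \<rho>"
  using eigensystem unfolding eigensystem_def by auto

lemma cov_op_sum_eigenvectors:
  assumes "F \<subseteq> K"
  shows "cov_op \<rho> (\<Sum>k\<in>F. a k *\<^sub>R \<psi> k) = (\<Sum>k\<in>F. (a k * \<mu> k) *\<^sub>R \<psi> k)"
  using assms by (auto simp: linear_sum[OF linear_cov_op] linear_scale[OF linear_cov_op]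
      cov_op_eigenvector subset_iff intro!: sum.cong)

text \<open>This says that the functions \<open>\<omega> \<mapsto> (\<psi> k \<bullet> \<omega>) / sqrt (\<mu> k)\<close> are orthonormal in \<open>L\<^sup>2(\<rho>)\<close>.\<close>

lemma cov_op_sum_eigenvectors_inner:
  assumes "finite F" "F \<subseteq> K"
  shows "cov_op \<rho> (\<Sum>k\<in>F. (a k / sqrt (\<mu> k)) *\<^sub>R \<psi> k) \<bullet> (\<Sum>k\<in>F. (a k / sqrt (\<mu> k)) *\<^sub>R \<psi> k)
    = (\<Sum>k\<in>F. (a k)\<^sup>2)"
  unfolding cov_op_sum_eigenvectors[OF assms(2)] orthonormal_inner_sum[OF orthonormal assms]
proof (rule sum.cong[OF refl])
  fix k assume "k \<in> F"
  then have "\<mu> k > 0" using assms eigenvalue_pos by blast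
  then show "a k / sqrt (\<mu> k) * \<mu> k * (a k / sqrt (\<mu> k)) = (a k)\<^sup>2"
    by (simp add: power2_eq_square)
qed

text \<open>The coefficients are determined on \<open>K\<close>, which makes the description defining \<open>HL_norm\<close> proper.\<close>

lemma HL_rep_inner:
  assumes "HL_rep K \<psi> \<mu> (1/2) v c" and k: "k \<in> K"
  shows "v \<bullet> \<psi> k = sqrt (\<mu> k) * c k"
proof (rule has_sum_unique)
  have "((\<lambda>j. (\<mu> j powr (1/2) * c j) *\<^sub>R \<psi> j) has_sum v) K"
    using assms by (simp add: HL_rep_def)
  from has_sum_bounded_linear[OF bounded_linear_inner_left this]
  show "((\<lambda>j. ((\<mu> j powr (1/2) * c j) *\<^sub>R \<psi> j) \<bullet> \<psi> k) has_sum (v \<bullet> \<psi> k)) K" .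
  show "((\<lambda>j. ((\<mu> j powr (1/2) * c j) *\<^sub>R \<psi> j) \<bullet> \<psi> k) has_sum (sqrt (\<mu> k) * c k)) K"
    using k orthonormal eigenvalue_pos[OF k]
    by (intro has_sum_finite_neutralI[of "{k}"]) (auto simp: powr_half_sqrt)
qed

lemma HL_norm_eq:
  assumes c: "HL_rep K \<psi> \<mu> (1/2) v c"
  shows "HL_norm K \<psi> \<mu> (1/2) v = sqrt (\<Sum>\<^sub>\<infinity>k\<in>K. (c k)\<^sup>2)"
  unfolding HL_norm_def
proof (rule the_equality)
  show "\<exists>c'. HL_rep K \<psi> \<mu> (1/2) v c' \<and> sqrt (\<Sum>\<^sub>\<infinity>k\<in>K. (c k)\<^sup>2) = sqrt (\<Sum>\<^sub>\<infinity>k\<in>K. (c' k)\<^sup>2)"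
    using c by blast
  fix x assume "\<exists>c'. HL_rep K \<psi> \<mu> (1/2) v c' \<and> x = sqrt (\<Sum>\<^sub>\<infinity>k\<in>K. (c' k)\<^sup>2)"
  then obtain c' where c': "HL_rep K \<psi> \<mu> (1/2) v c'" "x = sqrt (\<Sum>\<^sub>\<infinity>k\<in>K. (c' k)\<^sup>2)"
    by blast
  have "c' k = c k" if "k \<in> K" for k
    using HL_rep_inner[OF c that] HL_rep_inner[OF c'(1) that] eigenvalue_pos[OF that] by simp
  then show "x = sqrt (\<Sum>\<^sub>\<infinity>k\<in>K. (c k)\<^sup>2)"
    unfolding c'(2) by (metis (no_types, lifting) infsum_cong)
qed

lemma HL_norm_sq:
  assumes "HL_rep K \<psi> \<mu> (1/2) v c"
  shows "(HL_norm K \<psi> \<mu> (1/2) v)\<^sup>2 = (\<Sum>\<^sub>\<infinity>k\<in>K. (c k)\<^sup>2)"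
  using HL_norm_eq[OF assms] by (simp add: infsum_nonneg)

lemma A2_rep_imp_H_tilde:
  assumes a: "A2_rep \<rho> u a"
  shows "u \<in> H_tilde \<rho>"
proof -
  have "y \<bullet> u = 0" if y: "cov_op \<rho> y = 0" for y
  proof (rule ccontr)
    assume nz: "y \<bullet> u \<noteq> 0"
    \<comment> \<open>On the kernel the quadratic term vanishes, so a nonzero linear term would be unbounded;
      this multiple of \<open>y\<close> exceeds the bound by one.\<close>
    define t where "t = ((LINT \<omega>|\<rho>. (a \<omega>)\<^sup>2) + 1) / (2 * (y \<bullet> u))"
    have "cov_op \<rho> (t *\<^sub>R y) = 0"
      using linear_scale[OF linear_cov_op] y by simp
    then have "2 * t * (y \<bullet> u) \<le> (LINT \<omega>|\<rho>. (a \<omega>)\<^sup>2)"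
      using A2_rep_quadratic_le[OF a, of "t *\<^sub>R y"] by simp
    then show False
      using nz by (simp add: t_def)
  qed
  then show ?thesis
    by (auto simp: H_tilde_def orthogonal_comp_def orthogonal_def)
qed

text \<open>The coefficients \<open>c k\<close> are those of the density \<open>a\<close> with respect to the orthonormal functions
  \<open>(\<psi> k \<bullet> \<omega>) / sqrt (\<mu> k)\<close>. Membership in \<open>H_tilde\<close> makes the \<open>\<psi>\<close>-expansion of \<open>u\<close> converge to
  \<open>u\<close>, and Bessel's inequality bounds the norm.\<close>

lemma A2_rep_imp_HL_rep:
  assumes a: "A2_rep \<rho> u a"
  obtains c where "HL_rep K \<psi> \<mu> (1/2) u c" "(\<Sum>\<^sub>\<infinity>k\<in>K. (c k)\<^sup>2) \<le> (LINT \<omega>|\<rho>. (a \<omega>)\<^sup>2)"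
proof -
  define c where "c k = (u \<bullet> \<psi> k) / sqrt (\<mu> k)" for k
  have c: "\<mu> k powr (1/2) * c k = u \<bullet> \<psi> k" if "k \<in> K" for k
    using eigenvalue_pos[OF that] by (simp add: c_def powr_half_sqrt)
  have "((\<lambda>k. (u \<bullet> \<psi> k) *\<^sub>R \<psi> k) has_sum u) K"
    using has_sum_orthonormal_expansion[OF orthonormal] A2_rep_imp_H_tilde[OF a] closure_span_eq by blast
  then have 1: "((\<lambda>k. (\<mu> k powr (1/2) * c k) *\<^sub>R \<psi> k) has_sum u) K"
    by (rule has_sum_cong[THEN iffD1, rotated]) (simp only: c)
  have bessel: "(\<Sum>k\<in>F. (c k)\<^sup>2) \<le> (LINT \<omega>|\<rho>. (a \<omega>)\<^sup>2)" if F: "finite F" "F \<subseteq> K" for F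
  proof -
    \<comment> \<open>The function \<open>v \<bullet> \<omega>\<close> is the projection of \<open>a\<close> onto the span of the functions indexed by \<open>F\<close>.\<close>
    define v where "v = (\<Sum>k\<in>F. (c k / sqrt (\<mu> k)) *\<^sub>R \<psi> k)"
    have "cov_op \<rho> v \<bullet> v = (\<Sum>k\<in>F. (c k)\<^sup>2)"
      unfolding v_def by (rule cov_op_sum_eigenvectors_inner[OF F])
    moreover have "v \<bullet> u = (\<Sum>k\<in>F. (c k)\<^sup>2)"
      unfolding v_def inner_sum_left
      by (intro sum.cong refl) (simp add: c_def power2_eq_square inner_commute)
    ultimately show ?thesis
      using A2_rep_quadratic_le[OF a, of v] by simp
  qed
  then have 2: "(\<lambda>k. (c k)\<^sup>2) summable_on K"
    by (intro nonneg_bdd_above_summable_on bdd_aboveI[of _ "LINT \<omega>|\<rho>. (a \<omega>)\<^sup>2"]) auto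
  show thesis
  proof (rule that)
    show "HL_rep K \<psi> \<mu> (1/2) u c"
      using 1 2 by (simp add: HL_rep_def)
    show "(\<Sum>\<^sub>\<infinity>k\<in>K. (c k)\<^sup>2) \<le> (LINT \<omega>|\<rho>. (a \<omega>)\<^sup>2)"
      using 2 bessel by (rule infsum_le_finite_sums)
  qed
qed

text \<open>The density is the \<open>L\<^sup>2\<close> limit of the functions \<open>v n \<bullet> \<omega>\<close>, which represent the
  vectors \<open>cov_op \<rho> (v n)\<close>, the partial sums of the expansion of \<open>u\<close>. The vectors \<open>v n\<close> themselves need not
  converge.\<close>

lemma HL_rep_imp_A2_rep:
  assumes c: "HL_rep K \<psi> \<mu> (1/2) u c"
  obtains a where "A2_rep \<rho> u a" "(LINT \<omega>|\<rho>. (a \<omega>)\<^sup>2) \<le> (\<Sum>\<^sub>\<infinity>k\<in>K. (c k)\<^sup>2)"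
proof -
  define S where "S = (\<Sum>\<^sub>\<infinity>k\<in>K. (c k)\<^sup>2)"
  define F where "F n = K \<inter> {..<n}" for n
  define v where "v n = (\<Sum>k\<in>F n. (c k / sqrt (\<mu> k)) *\<^sub>R \<psi> k)" for n
  define s where "s n = (\<Sum>k\<in>F n. (c k)\<^sup>2)" for n
  have F: "finite (F n)" "F n \<subseteq> K" for n by (auto simp: F_def)
  have sum: "(\<lambda>k. (c k)\<^sup>2) summable_on K"
    using c by (simp add: HL_rep_def)
  then have "s \<longlonglongrightarrow> S"
    unfolding s_def S_def F_def by (intro has_sum_imp_initial_sums_tendsto has_sum_infsum)
  then have s: "Cauchy s" by (rule LIMSEQ_imp_Cauchy)
  have s_le: "s n \<le> S" for n
    unfolding s_def S_def by (rule finite_sum_le_infsum[OF sum F]) simp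
  have int_sq: "(LINT \<omega>|\<rho>. (v n \<bullet> \<omega>)\<^sup>2) = s n" for n
    unfolding integral_inner_sq v_def s_def by (rule cov_op_sum_eigenvectors_inner[OF F])
  have int_diff: "(LINT \<omega>|\<rho>. (v m \<bullet> \<omega> - v n \<bullet> \<omega>)\<^sup>2) = s m - s n" if "n \<le> m" for m n
  proof -
    have sub: "F n \<subseteq> F m" using that by (auto simp: F_def)
    have "v m - v n = (\<Sum>k\<in>F m - F n. (c k / sqrt (\<mu> k)) *\<^sub>R \<psi> k)"
      unfolding v_def by (rule sum_diff[OF F(1) sub, symmetric])
    then have "(LINT \<omega>|\<rho>. ((v m - v n) \<bullet> \<omega>)\<^sup>2) = (\<Sum>k\<in>F m - F n. (c k)\<^sup>2)"
      unfolding integral_inner_sq using F[of m] by (simp only:) (intro cov_op_sum_eigenvectors_inner, auto)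
    also have "\<dots> = s m - s n"
      unfolding s_def by (rule sum_diff[OF F(1) sub])
    finally show ?thesis by (simp add: inner_diff_left)
  qed
  have nonneg: "0 \<le> (LINT \<omega>|\<rho>. (v m \<bullet> \<omega> - v n \<bullet> \<omega>)\<^sup>2)" for m n
    by simp
  have int_abs: "(LINT \<omega>|\<rho>. (v m \<bullet> \<omega> - v n \<bullet> \<omega>)\<^sup>2) = \<bar>s m - s n\<bar>" for m n
  proof (cases "n \<le> m")
    case True
    then show ?thesis
      using int_diff[OF True] nonneg[of m n] by linarith
  next
    case False
    have "(LINT \<omega>|\<rho>. (v m \<bullet> \<omega> - v n \<bullet> \<omega>)\<^sup>2) = (LINT \<omega>|\<rho>. (v n \<bullet> \<omega> - v m \<bullet> \<omega>)\<^sup>2)"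
      by (simp only: power2_commute)
    then show ?thesis
      using int_diff[of m n] nonneg[of n m] False by linarith
  qed
  obtain a where a: "a \<in> borel_measurable \<rho>" "integrable \<rho> (\<lambda>\<omega>. (a \<omega>)\<^sup>2)" "(LINT \<omega>|\<rho>. (a \<omega>)\<^sup>2) \<le> S"
    "(\<lambda>n. LINT \<omega>|\<rho>. (v n \<bullet> \<omega> - a \<omega>)\<^sup>2) \<longlonglongrightarrow> 0"
    "\<And>n. integrable \<rho> (\<lambda>\<omega>. (v n \<bullet> \<omega> - a \<omega>)\<^sup>2)"
  proof (rule L2_complete[of "\<lambda>n \<omega>. v n \<bullet> \<omega>" S])
    show "\<exists>N. \<forall>m\<ge>N. \<forall>n\<ge>N. (LINT \<omega>|\<rho>. (v m \<bullet> \<omega> - v n \<bullet> \<omega>)\<^sup>2) < e" if "e > 0" for e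
      using s that unfolding int_abs Cauchy_def dist_real_def by blast
  qed (auto simp: int_sq s_le)
  note [measurable] = a(1)
  have a_int: "integrable \<rho> a"
    using a(1,2) by (rule square_integrable_imp_integrable)
  have a_vec: "integrable \<rho> (\<lambda>\<omega>. a \<omega> *\<^sub>R \<omega>)"
    by (rule Bochner_Integration.integrable_bound[OF a_int]) (auto simp: norm_on_sphere)
  have "(\<lambda>n. cov_op \<rho> (v n)) \<longlonglongrightarrow> (LINT \<omega>|\<rho>. a \<omega> *\<^sub>R \<omega>)"
  proof (rule LIM_zero_cancel, rule Lim_null_comparison)
    show "(\<lambda>n. sqrt (LINT \<omega>|\<rho>. (v n \<bullet> \<omega> - a \<omega>)\<^sup>2)) \<longlonglongrightarrow> 0"
      using tendsto_real_sqrt[OF a(4)] by simp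
    have "norm (cov_op \<rho> (v n) - (LINT \<omega>|\<rho>. a \<omega> *\<^sub>R \<omega>)) \<le> sqrt (LINT \<omega>|\<rho>. (v n \<bullet> \<omega> - a \<omega>)\<^sup>2)" for n
    proof -
      have "cov_op \<rho> (v n) - (LINT \<omega>|\<rho>. a \<omega> *\<^sub>R \<omega>) = (LINT \<omega>|\<rho>. (v n \<bullet> \<omega> - a \<omega>) *\<^sub>R \<omega>)"
        unfolding cov_op_def scaleR_left_diff_distrib
        using Bochner_Integration.integral_diff[OF integrable_cov a_vec, of "v n"] by simp
      also have "norm \<dots> \<le> (LINT \<omega>|\<rho>. norm ((v n \<bullet> \<omega> - a \<omega>) *\<^sub>R \<omega>))"
        by (rule integral_norm_bound)
      also have "\<dots> = (LINT \<omega>|\<rho>. \<bar>v n \<bullet> \<omega> - a \<omega>\<bar>)"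
        by (intro Bochner_Integration.integral_cong refl) (simp add: norm_on_sphere)
      also have "\<dots> \<le> sqrt (LINT \<omega>|\<rho>. (v n \<bullet> \<omega> - a \<omega>)\<^sup>2)"
        using expectation_square_le[of "\<lambda>\<omega>. \<bar>v n \<bullet> \<omega> - a \<omega>\<bar>"] a(5)[of n]
        by (intro real_le_rsqrt) simp
      finally show ?thesis .
    qed
    then show "\<forall>\<^sub>F n in sequentially. norm (cov_op \<rho> (v n) - (LINT \<omega>|\<rho>. a \<omega> *\<^sub>R \<omega>))
        \<le> sqrt (LINT \<omega>|\<rho>. (v n \<bullet> \<omega> - a \<omega>)\<^sup>2)"
      by simp
  qed
  moreover have "(\<lambda>n. cov_op \<rho> (v n)) \<longlonglongrightarrow> u"
  proof -
    have "cov_op \<rho> (v n) = (\<Sum>k\<in>F n. (\<mu> k powr (1/2) * c k) *\<^sub>R \<psi> k)" for n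
      unfolding v_def cov_op_sum_eigenvectors[OF F(2)]
    proof (rule sum.cong[OF refl])
      fix k assume "k \<in> F n"
      then have "\<mu> k > 0" using F eigenvalue_pos by blast
      then have "c k / sqrt (\<mu> k) * \<mu> k = \<mu> k powr (1/2) * c k"
        by (simp add: powr_half_sqrt real_div_sqrt field_simps)
      then show "(c k / sqrt (\<mu> k) * \<mu> k) *\<^sub>R \<psi> k = (\<mu> k powr (1/2) * c k) *\<^sub>R \<psi> k"
        by simp
    qed
    then have "(\<lambda>n. cov_op \<rho> (v n)) = (\<lambda>n. \<Sum>k\<in>K \<inter> {..<n}. (\<mu> k powr (1/2) * c k) *\<^sub>R \<psi> k)"
      unfolding F_def by blast
    moreover have "((\<lambda>k. (\<mu> k powr (1/2) * c k) *\<^sub>R \<psi> k) has_sum u) K"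
      using c unfolding HL_rep_def by blast
    ultimately show ?thesis
      by (simp only: has_sum_imp_initial_sums_tendsto)
  qed
  ultimately have "u = (LINT \<omega>|\<rho>. a \<omega> *\<^sub>R \<omega>)"
    by (rule LIMSEQ_unique[rotated])
  then show thesis
    using that[of a] a a_vec by (simp add: A2_rep_def S_def)
qed

lemma A2_eq_HL_space: "A2 \<rho> = HL_space K \<psi> \<mu> (1/2)"
proof (intro set_eqI iffI)
  fix u assume "u \<in> A2 \<rho>"
  then obtain a where "A2_rep \<rho> u a"
    unfolding A2_def by blast
  then obtain c where "HL_rep K \<psi> \<mu> (1/2) u c"
    by (rule A2_rep_imp_HL_rep)
  then show "u \<in> HL_space K \<psi> \<mu> (1/2)"
    unfolding HL_space_def by blast
next
  fix u assume "u \<in> HL_space K \<psi> \<mu> (1/2)"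
  then obtain c where "HL_rep K \<psi> \<mu> (1/2) u c"
    unfolding HL_space_def by blast
  then obtain a where "A2_rep \<rho> u a"
    by (rule HL_rep_imp_A2_rep)
  then show "u \<in> A2 \<rho>"
    unfolding A2_def by blast
qed

lemma HL_norm_sq_le:
  assumes "A2_rep \<rho> u a"
  shows "(HL_norm K \<psi> \<mu> (1/2) u)\<^sup>2 \<le> (LINT \<omega>|\<rho>. (a \<omega>)\<^sup>2)"
proof -
  obtain c where c: "HL_rep K \<psi> \<mu> (1/2) u c" "(\<Sum>\<^sub>\<infinity>k\<in>K. (c k)\<^sup>2) \<le> (LINT \<omega>|\<rho>. (a \<omega>)\<^sup>2)"
    using A2_rep_imp_HL_rep[OF assms] .
  show ?thesis
    unfolding HL_norm_sq[OF c(1)] by (rule c(2))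
qed

lemma HL_norm_attained:
  assumes "u \<in> HL_space K \<psi> \<mu> (1/2)"
  obtains a where "A2_rep \<rho> u a" "(LINT \<omega>|\<rho>. (a \<omega>)\<^sup>2) = (HL_norm K \<psi> \<mu> (1/2) u)\<^sup>2"
proof -
  obtain c where c: "HL_rep K \<psi> \<mu> (1/2) u c"
    using assms unfolding HL_space_def by blast
  obtain a where a: "A2_rep \<rho> u a" "(LINT \<omega>|\<rho>. (a \<omega>)\<^sup>2) \<le> (\<Sum>\<^sub>\<infinity>k\<in>K. (c k)\<^sup>2)"
    using HL_rep_imp_A2_rep[OF c] .
  have "(LINT \<omega>|\<rho>. (a \<omega>)\<^sup>2) = (HL_norm K \<psi> \<mu> (1/2) u)\<^sup>2"
    using a(2) HL_norm_sq_le[OF a(1)] HL_norm_sq[OF c] by linarith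
  with a(1) show thesis by (rule that)
qed

lemma HL_norm_nonneg:
  assumes "u \<in> HL_space K \<psi> \<mu> (1/2)"
  shows "0 \<le> HL_norm K \<psi> \<mu> (1/2) u"
proof -
  obtain c where c: "HL_rep K \<psi> \<mu> (1/2) u c"
    using assms unfolding HL_space_def by blast
  show ?thesis
    unfolding HL_norm_eq[OF c] by (simp add: infsum_nonneg)
qed

lemma A2_norm_eq_HL_norm:
  assumes u: "u \<in> HL_space K \<psi> \<mu> (1/2)"
  shows "A2_norm \<rho> u = HL_norm K \<psi> \<mu> (1/2) u"
  unfolding A2_norm_def
proof (rule cInf_eq_minimum)
  show "HL_norm K \<psi> \<mu> (1/2) u \<in> {sqrt (LINT \<omega>|\<rho>. (c \<omega>)\<^sup>2) |c. A2_rep \<rho> u c}"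
  proof -
    obtain a where a: "A2_rep \<rho> u a" "(LINT \<omega>|\<rho>. (a \<omega>)\<^sup>2) = (HL_norm K \<psi> \<mu> (1/2) u)\<^sup>2"
      using HL_norm_attained[OF u] .
    then have "HL_norm K \<psi> \<mu> (1/2) u = sqrt (LINT \<omega>|\<rho>. (a \<omega>)\<^sup>2)"
      using HL_norm_nonneg[OF u] by simp
    with a(1) show ?thesis by blast
  qed
  show "HL_norm K \<psi> \<mu> (1/2) u \<le> x" if "x \<in> {sqrt (LINT \<omega>|\<rho>. (c \<omega>)\<^sup>2) |c. A2_rep \<rho> u c}" for x
    using that by (auto intro: real_le_rsqrt HL_norm_sq_le)
qed

text \<open>Finite sums of eigenvectors lie in the range of \<open>L\<close>, and \<open>L v\<close> is represented by the density
  \<open>v \<bullet> \<omega>\<close>.\<close>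

lemma A2_dense:
  assumes u: "u \<in> H_tilde \<rho>" and e: "e > 0"
  obtains h a where "A2_rep \<rho> h a" "norm (u - h) \<le> e"
proof -
  have "((\<lambda>k. (u \<bullet> \<psi> k) *\<^sub>R \<psi> k) has_sum u) K"
    using has_sum_orthonormal_expansion[OF orthonormal] u closure_span_eq by blast
  from has_sum_finite_approximation[OF this e]
  obtain F where F: "finite F" "F \<subseteq> K" "dist (\<Sum>k\<in>F. (u \<bullet> \<psi> k) *\<^sub>R \<psi> k) u \<le> e"
    by blast
  define v where "v = (\<Sum>k\<in>F. ((u \<bullet> \<psi> k) / \<mu> k) *\<^sub>R \<psi> k)"
  have "A2_rep \<rho> (cov_op \<rho> v) (\<lambda>\<omega>. v \<bullet> \<omega>)"
    unfolding A2_rep_def by (simp add: integrable_cov cov_op_def)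
  moreover have "cov_op \<rho> v = (\<Sum>k\<in>F. (u \<bullet> \<psi> k) *\<^sub>R \<psi> k)"
    unfolding v_def cov_op_sum_eigenvectors[OF F(2)]
  proof (rule sum.cong[OF refl])
    fix k assume "k \<in> F"
    then have "\<mu> k > 0" using F eigenvalue_pos by blast
    then show "(u \<bullet> \<psi> k / \<mu> k * \<mu> k) *\<^sub>R \<psi> k = (u \<bullet> \<psi> k) *\<^sub>R \<psi> k"
      by simp
  qed
  ultimately show thesis
    using F(3) by (intro that[of "cov_op \<rho> v"]) (simp_all add: dist_norm norm_minus_commute)
qed

end

lemma (in iid_sphere_samples) expected_delta_sq_tendsto_0:
  assumes approx: "\<And>e. e > 0 \<Longrightarrow> \<exists>h a. A2_rep \<rho> h a \<and> norm (u - h) \<le> e"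
  shows "(\<lambda>m. expected_delta_sq M W u m) \<longlonglongrightarrow> 0"
proof -
  have "(\<lambda>m. sqrt (expected_delta_sq M W u m)) \<longlonglongrightarrow> 0"
  proof (rule LIMSEQ_I)
    fix e :: real assume e: "e > 0"
    obtain h a where a: "A2_rep \<rho> h a" and h: "norm (u - h) \<le> e / 4"
      using approx[of "e / 4"] e by auto
    define q where "q = sqrt ((LINT \<omega>|\<rho>. (a \<omega>)\<^sup>2) + (norm u)\<^sup>2)"
    have "(\<lambda>m. q / sqrt (real m + 1)) \<longlonglongrightarrow> 0"
      by real_asymp
    then obtain N where N: "\<And>m. m \<ge> N \<Longrightarrow> \<bar>q / sqrt (real m + 1)\<bar> < e / 4"
      using LIMSEQ_D[of _ 0 "e / 4"] e by fastforce
    have "norm (sqrt (expected_delta_sq M W u m) - 0) < e" if "m \<ge> N" for m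
    proof -
      have "sqrt (expected_delta_sq M W u m) \<le> 2 * (norm (u - h) + q / sqrt (real m + 1))"
        unfolding q_def by (rule sqrt_expected_delta_sq_le_of_A2[OF a])
      also have "\<dots> < e"
      proof -
        define y where "y = q / sqrt (real m + 1)"
        have "\<bar>y\<bar> < e / 4"
          using N[OF that] by (simp only: y_def)
        then show ?thesis
          using h e unfolding y_def[symmetric] distrib_left by linarith
      qed
      finally show ?thesis
        by (simp add: expected_delta_sq_nonneg)
    qed
    then show "\<exists>N. \<forall>m\<ge>N. norm (sqrt (expected_delta_sq M W u m) - 0) < e"
      by blast
  qed
  from tendsto_power[OF this, of 2] show ?thesis
    by (simp add: expected_delta_sq_nonneg)
qed

theorem theorem3:
  fixes \<rho> :: "'a::{real_inner, banach, second_countable_topology} measure"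
    and K :: "nat set" and \<psi> :: "nat \<Rightarrow> 'a" and \<mu> :: "nat \<Rightarrow> real"
    and M :: "'b measure" and W :: "nat \<Rightarrow> 'b \<Rightarrow> 'a"
  assumes "sphere_prob \<rho>"
    and "eigensystem \<rho> K \<psi> \<mu>"
    and "iid_samples M \<rho> W"
  shows "(\<forall>u m. integrable M (\<lambda>x. delta_sq u (\<lambda>i. W i x) m)) \<and>
    (\<forall>u \<in> HL_space K \<psi> \<mu> (1/2).
       (\<lambda>m. expected_delta_sq M W u m) \<longlonglongrightarrow> 0 \<and>
       (\<forall>m. expected_delta_sq M W u m \<le> (HL_norm K \<psi> \<mu> (1/2) u)\<^sup>2 / (real m + 1))) \<and>
    (\<forall>u. \<forall>h \<in> HL_space K \<psi> \<mu> (1/2). \<forall>m.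
       sqrt (expected_delta_sq M W u m)
         \<le> 2 * (norm (u - h)
             + sqrt ((HL_norm K \<psi> \<mu> (1/2) h)\<^sup>2 + (norm u)\<^sup>2) / sqrt (real m + 1))) \<and>
    (\<forall>u \<in> H_tilde \<rho>. (\<lambda>m. expected_delta_sq M W u m) \<longlonglongrightarrow> 0) \<and>
    (A2 \<rho> = HL_space K \<psi> \<mu> (1/2) \<and>
     (\<forall>u \<in> HL_space K \<psi> \<mu> (1/2). A2_norm \<rho> u = HL_norm K \<psi> \<mu> (1/2) u))"
proof -
  interpret sphere_measure \<rho>
    using assms(1) by (simp add: sphere_prob_def sphere_measure_def sphere_measure_axioms_def)
  interpret covariance_eigensystem \<rho> K \<psi> \<mu>
    by standard (rule assms(2))
  interpret M: prob_space M
    using assms(3) by (simp add: iid_samples_def)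
  interpret iid_sphere_samples \<rho> M W
    by standard (use assms(3) in \<open>simp_all add: iid_samples_def\<close>)
  have lim: "(\<lambda>m. expected_delta_sq M W u m) \<longlonglongrightarrow> 0" if u: "u \<in> H_tilde \<rho>" for u
  proof (rule expected_delta_sq_tendsto_0)
    fix e :: real assume "e > 0"
    then obtain h a where "A2_rep \<rho> h a" "norm (u - h) \<le> e"
      by (rule A2_dense[OF u])
    then show "\<exists>h a. A2_rep \<rho> h a \<and> norm (u - h) \<le> e" by blast
  qed
  show ?thesis
  proof (intro conjI allI ballI)
    show "integrable M (\<lambda>x. delta_sq u (\<lambda>i. W i x) m)" for u m
      unfolding delta_sq_def by (rule integrable_residual_sq)
    fix u assume "u \<in> HL_space K \<psi> \<mu> (1/2)"
    then obtain a where a: "A2_rep \<rho> u a" "(LINT \<omega>|\<rho>. (a \<omega>)\<^sup>2) = (HL_norm K \<psi> \<mu> (1/2) u)\<^sup>2"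
      by (rule HL_norm_attained)
    show "(\<lambda>m. expected_delta_sq M W u m) \<longlonglongrightarrow> 0"
      using A2_rep_imp_H_tilde[OF a(1)] by (rule lim)
    show "expected_delta_sq M W u m \<le> (HL_norm K \<psi> \<mu> (1/2) u)\<^sup>2 / (real m + 1)" for m
      using expected_delta_sq_le_of_A2[OF a(1), of m] unfolding a(2) .
  next
    fix u h m assume "h \<in> HL_space K \<psi> \<mu> (1/2)"
    then obtain a where a: "A2_rep \<rho> h a" "(LINT \<omega>|\<rho>. (a \<omega>)\<^sup>2) = (HL_norm K \<psi> \<mu> (1/2) h)\<^sup>2"
      by (rule HL_norm_attained)
    show "sqrt (expected_delta_sq M W u m)
        \<le> 2 * (norm (u - h) + sqrt ((HL_norm K \<psi> \<mu> (1/2) h)\<^sup>2 + (norm u)\<^sup>2) / sqrt (real m + 1))"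
      using sqrt_expected_delta_sq_le_of_A2[OF a(1), of u m] unfolding a(2) .
  qed (simp_all add: lim A2_eq_HL_space A2_norm_eq_HL_norm)
qed

end
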